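(* Let $\mathcal{A}\in\mathbb{C}^{n_1\times n_1\times n_3}$ and $\mathrm{Ind}(\mathcal{A})=k$. For $i=1,\dots,n_3$ let $\mathbf{C}_{\mathbf{A}_i}$ and $\mathbf{N}_{\mathbf{A}_i}$ be the core part and the nilpotent part of the matrix $L(\mathcal{A})^{(i)}$. Then there exist an invertible tensor $\mathcal{P}\in\mathbb{C}^{n_1\times n_1\times n_3}$, with $\mathbf{P}_i:=L(\mathcal{P})^{(i)}$, and, for each $i$, square matrices $\mathbf{C}_i$ (nonsingular) and $\mathbf{N}_i$ whose sizes add up to $n_1$, such that $$\mathbf{P}_i^{-1}\mathbf{C}_{\mathbf{A}_i}\mathbf{P}_i=\begin{bmatrix}\mathbf{C}_i&\mathbf{O}\\ \mathbf{O}&\mathbf{O}\end{bmatrix},\qquad \mathbf{P}_i^{-1}\mathbf{N}_{\mathbf{A}_i}\mathbf{P}_i=\begin{bmatrix}\mathbf{O}&\mathbf{O}\\ \mathbf{O}&\mathbf{N}_i\end{bmatrix}$$ (so $\begin{bmatrix}\mathbf{C}_i&\mathbf{O}\\ \mathbf{O}&\mathbf{N}_i\end{bmatrix}=\mathbf{P}_i^{-1}(\mathbf{C}_{\mathbf{A}_i}+\mathbf{N}_{\mathbf{A}_i})\mathbf{P}_i$), and $$\mathcal{A}=\mathcal{P}*_c\Phi*_c\mathcal{P}^{-1},$$ where $\Phi\in\mathbb{C}^{n_1\times n_1\times n_3}$ is the tensor with $L(\Phi)^{(i)}=\begin{bmatrix}\mathbf{C}_i&\mathbf{O}\\ \mathbf{O}&\mathbf{N}_i\end{bmatrix}$,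 $i=1,\dots,n_3$. Furthermore, if $\mathrm{rank}(\mathbf{C}_i)=r$ for all $i=1,\dots,n_3$, then, with $\mathcal{C}\in\mathbb{C}^{r\times r\times n_3}$ and $\mathcal{N}\in\mathbb{C}^{(n_1-r)\times(n_1-r)\times n_3}$ the tensors given by $L(\mathcal{C})^{(i)}=\mathbf{C}_i$ and $L(\mathcal{N})^{(i)}=\mathbf{N}_i$, $$\mathcal{A}=\mathcal{P}*_c\begin{bmatrix}\mathcal{C}&\mathcal{O}\\ \mathcal{O}&\mathcal{N}\end{bmatrix}*_c\mathcal{P}^{-1}\qquad\text{and}\qquad \mathcal{A}^D=\mathcal{P}*_c\begin{bmatrix}\mathcal{C}^{-1}&\mathcal{O}\\ \mathcal{O}&\mathcal{O}\end{bmatrix}*_c\mathcal{P}^{-1}.$$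
   Context: For a third-order tensor $\mathcal{A}\in\mathbb{C}^{n_1\times n_2\times n_3}$, $\mathcal{A}^{(i)}=\mathcal{A}(:,:,i)\in\mathbb{C}^{n_1\times n_2}$ denotes its $i$-th frontal slice. Let $\mathbf{C}_{n_3}$ be the $n_3\times n_3$ orthogonal DCT matrix (notation used only here), with entries $(\mathbf{C}_{n_3})_{jk}=\sqrt{(2-\delta_{j1})/n_3}\,\cos\big(\tfrac{(j-1)(2k-1)\pi}{2n_3}\big)$; let $\mathbf{W}$ be the diagonal matrix whose diagonal is the first column of $\mathbf{C}_{n_3}$; let $\mathbf{Z}$ be the $n_3\times n_3$ matrix with ones on the first superdiagonal and zeros elsewhere; and put $\mathbf{M}=\mathbf{W}^{-1}\mathbf{C}_{n_3}(\mathbf{I}+\mathbf{Z})$, an invertible matrix. Define the linear bijection $L$ on tensors with third dimension $n_3$ by $L(\mathcal{A})_{ijk}=\sum_{l=1}^{n_3}\mathbf{M}_{kl}\mathcal{A}_{ijl}$. The C-product of $\mathcal{A}\in\mathbb{C}^{n_1\times n_2\times n_3}$ and $\mathcal{B}\in\mathbb{C}^{n_2\times l\times n_3}$ is the tensor $\mathcal{A}*_c\mathcal{B}\in\mathbb{C}^{n_1\times l\times n_3}$ determined by $L(\mathcal{A}*_c\mathcal{B})^{(i)}=L(\mathcal{A})^{(i)}L(\mathcal{B})^{(i)}$, $i=1,\dots,n_3$. The identity tensor $\mathcal{I}\in\mathbb{C}^{n\times n\times n_3}$ is determined by $L(\mathcal{I})^{(i)}=\mathbf{I}_n$ for all $i$.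 Powers are with respect to $*_c$, with $\mathcal{A}^0=\mathcal{I}$. The inverse $\mathcal{B}^{-1}$ of $\mathcal{B}\in\mathbb{C}^{n\times n\times n_3}$ is the tensor with $\mathcal{B}*_c\mathcal{B}^{-1}=\mathcal{B}^{-1}*_c\mathcal{B}=\mathcal{I}$. Block notation partitions tensors along the first two modes; $\mathcal{O}$ denotes zero tensors. $\mathrm{mat}(\mathcal{A})$ is the $n_3\times n_3$ block Toeplitz-plus-Hankel matrix whose $(p,q)$ block is $\mathcal{A}^{(|p-q|+1)}+\mathbf{H}_{pq}$, where $\mathbf{H}_{pq}=\mathcal{A}^{(p+q)}$ if $p+q\le n_3$, $\mathbf{H}_{pq}=O$ if $p+q=n_3+1$, and $\mathbf{H}_{pq}=\mathcal{A}^{(2n_3+2-p-q)}$ if $p+q\ge n_3+2$. The index $\mathrm{Ind}(A)$ of a square matrix $A$ is the smallest nonnegative integer $k$ with $\mathrm{rank}(A^k)=\mathrm{rank}(A^{k+1})$, and $\mathrm{Ind}(\mathcal{A})=\mathrm{Ind}(\mathrm{mat}(\mathcal{A}))$. If $\mathrm{Ind}(\mathcal{A})=k$, the Drazin inverse $\mathcal{A}^D$ is the (unique) tensor $\mathcal{X}\in\mathbb{C}^{n_1\times n_1\times n_3}$ with $\mathcal{A}^{k+1}*_c\mathcal{X}=\mathcal{A}^k$, $\mathcal{X}*_c\mathcal{A}*_c\mathcal{X}=\mathcal{X}$, $\mathcal{A}*_c\mathcal{X}=\mathcal{X}*_c\mathcal{A}$. For a square matrix $\mathbf{A}$ with Drazin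 inverse $\mathbf{A}^D$, its core part is $\mathbf{C}_{\mathbf{A}}=\mathbf{A}^2\mathbf{A}^D$ and its nilpotent part is $\mathbf{N}_{\mathbf{A}}=\mathbf{A}-\mathbf{C}_{\mathbf{A}}$. *)

theory Defs
  imports Complex_Main
    "Jordan_Normal_Form.Gauss_Jordan_Elimination"
    "Jordan_Normal_Form.DL_Rank"
begin

(* A third-order tensor is the list of its frontal slices: A(i,j,k) is (A ! k) $$ (i,j).
   All indices are 0-based, so slice number k of the usual notation is A ! (k - 1). *)

type_synonym ctensor = "complex mat list"

definition tensor_carrier :: "nat \<Rightarrow> nat \<Rightarrow> nat \<Rightarrow> ctensor set" where
  "tensor_carrier n1 n2 n3 = {A. length A = n3 \<and> set A \<subseteq> carrier_mat n1 n2}"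

definition trows :: "ctensor \<Rightarrow> nat" where
  "trows A = dim_row (hd A)"

definition tcols :: "ctensor \<Rightarrow> nat" where
  "tcols A = dim_col (hd A)"

definition tzero :: "nat \<Rightarrow> nat \<Rightarrow> nat \<Rightarrow> ctensor" where
  "tzero n1 n2 n3 = replicate n3 (0\<^sub>m n1 n2)"

definition tblock :: "ctensor \<Rightarrow> ctensor \<Rightarrow> ctensor \<Rightarrow> ctensor \<Rightarrow> ctensor" where
  "tblock A B C D = map (\<lambda>i. four_block_mat (A ! i) (B ! i) (C ! i) (D ! i)) [0..<length A]"


(* Only meaningful for invertible A. *)
definition minv :: "complex mat \<Rightarrow> complex mat" where
  "minv A = the (mat_inverse A)"

definition mrank :: "complex mat \<Rightarrow> nat" where
  "mrank A = vec_space.rank (dim_row A) A"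

definition mindex :: "complex mat \<Rightarrow> nat" where
  "mindex A = (LEAST k. mrank (A ^\<^sub>m k) = mrank (A ^\<^sub>m (k + 1)))"

definition mdrazin :: "complex mat \<Rightarrow> complex mat" where
  "mdrazin A = (THE X. X \<in> carrier_mat (dim_row A) (dim_row A) \<and>
     A ^\<^sub>m (mindex A + 1) * X = A ^\<^sub>m (mindex A) \<and> X * A * X = X \<and> A * X = X * A)"

definition core_part :: "complex mat \<Rightarrow> complex mat" where
  "core_part A = A ^\<^sub>m 2 * mdrazin A"

definition nilpotent_part :: "complex mat \<Rightarrow> complex mat" where
  "nilpotent_part A = A - core_part A"


(* With 0-based j and k, the usual (j - 1)(2k - 1) becomes j(2k + 1). *)
definition dct_mat :: "nat \<Rightarrow> complex mat" where
  "dct_mat n = mat n n (\<lambda>(j, k). complex_of_real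
     (sqrt ((2 - (if j = 0 then 1 else 0)) / real n) *
      cos (real j * (2 * real k + 1) * pi / (2 * real n))))"

definition W_mat :: "nat \<Rightarrow> complex mat" where
  "W_mat n = mat_diag n (\<lambda>i. dct_mat n $$ (i, 0))"

definition Z_mat :: "nat \<Rightarrow> complex mat" where
  "Z_mat n = mat n n (\<lambda>(i, j). if j = i + 1 then 1 else 0)"

definition M_mat :: "nat \<Rightarrow> complex mat" where
  "M_mat n = minv (W_mat n) * dct_mat n * (1\<^sub>m n + Z_mat n)"

definition L_trans :: "ctensor \<Rightarrow> ctensor" where
  "L_trans A = map (\<lambda>k. mat (trows A) (tcols A)
     (\<lambda>(i, j). \<Sum>l<length A. M_mat (length A) $$ (k, l) * (A ! l) $$ (i, j))) [0..<length A]"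

(* The tensor determined by the frontal slices of its image under L. *)
definition tensor_from_L :: "nat \<Rightarrow> nat \<Rightarrow> nat \<Rightarrow> (nat \<Rightarrow> complex mat) \<Rightarrow> ctensor" where
  "tensor_from_L n1 n2 n3 S =
     (THE X. X \<in> tensor_carrier n1 n2 n3 \<and> (\<forall>i<n3. L_trans X ! i = S i))"

definition cprod :: "ctensor \<Rightarrow> ctensor \<Rightarrow> ctensor" (infixl "*\<^sub>c" 70) where
  "A *\<^sub>c B = tensor_from_L (trows A) (tcols B) (length A) (\<lambda>i. L_trans A ! i * L_trans B ! i)"

definition tid :: "nat \<Rightarrow> nat \<Rightarrow> ctensor" where
  "tid n n3 = tensor_from_L n n n3 (\<lambda>_. 1\<^sub>m n)"

fun tpow :: "ctensor \<Rightarrow> nat \<Rightarrow> ctensor" where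
  "tpow A 0 = tid (trows A) (length A)"
| "tpow A (Suc m) = tpow A m *\<^sub>c A"

definition is_tinverse :: "ctensor \<Rightarrow> ctensor \<Rightarrow> bool" where
  "is_tinverse B X \<longleftrightarrow> X \<in> tensor_carrier (trows B) (trows B) (length B) \<and>
     B *\<^sub>c X = tid (trows B) (length B) \<and> X *\<^sub>c B = tid (trows B) (length B)"

definition tinvertible :: "ctensor \<Rightarrow> bool" where
  "tinvertible B \<longleftrightarrow> (\<exists>X. is_tinverse B X)"

definition tinv :: "ctensor \<Rightarrow> ctensor" where
  "tinv B = (THE X. is_tinverse B X)"


(* Block (p,q) of the Toeplitz-plus-Hankel matrix. In 1-based terms (p' = p + 1, q' = q + 1) the
   Hankel part is slice p' + q', zero, or slice 2 n3 + 2 - p' - q'; the 0-based number of a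
   slice is one less. *)
definition tmat_block :: "ctensor \<Rightarrow> nat \<Rightarrow> nat \<Rightarrow> complex mat" where
  "tmat_block A p q = (let n3 = length A; p' = p + 1; q' = q + 1 in
     A ! nat \<bar>int p - int q\<bar> +
     (if p' + q' \<le> n3 then A ! (p' + q' - 1)
      else if p' + q' = n3 + 1 then 0\<^sub>m (trows A) (tcols A)
      else A ! (2 * n3 + 2 - p' - q' - 1)))"

definition tmat :: "ctensor \<Rightarrow> complex mat" where
  "tmat A = mat (trows A * length A) (tcols A * length A)
     (\<lambda>(i, j). tmat_block A (i div trows A) (j div tcols A) $$ (i mod trows A, j mod tcols A))"

definition tindex :: "ctensor \<Rightarrow> nat" where
  "tindex A = mindex (tmat A)"

definition tdrazin :: "ctensor \<Rightarrow> ctensor" where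
  "tdrazin A = (THE X. X \<in> tensor_carrier (trows A) (trows A) (length A) \<and>
     tpow A (tindex A + 1) *\<^sub>c X = tpow A (tindex A) \<and>
     X *\<^sub>c A *\<^sub>c X = X \<and> A *\<^sub>c X = X *\<^sub>c A)"

end

theory Submission
  imports Defs "Jordan_Normal_Form.Jordan_Normal_Form_Existence"
begin

text \<open>
  The map \<open>L\<close> turns the C-product into slicewise matrix multiplication, so once \<open>L\<close> is known to be
  bijective (\<open>L_trans_inject\<close>, \<open>L_trans_surject\<close>), every tensor equation in the theorem may be checked
  on each slice \<open>L(A)_i\<close> separately. Bijectivity is the invertibility of the matrix \<open>M\<close>, which is a
  product of a diagonal matrix with nonzero diagonal, the orthogonal DCT matrix and a unitriangular
  matrix.

  On a single slice the claim is the core-nilpotent decomposition of a complex matrix: sorting the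
  Jordan blocks by whether their eigenvalue vanishes gives \<open>P (C \<oplus> N) P\<^sup>-\<^sup>1\<close> with \<open>C\<close> invertible and \<open>N\<close>
  nilpotent (\<open>core_nilpotent_form_exists\<close>). In these coordinates the Drazin inverse is
  \<open>P (C\<^sup>-\<^sup>1 \<oplus> 0) P\<^sup>-\<^sup>1\<close>, and core and nilpotent part can be read off (\<open>core_nilpotent_form_parts\<close>).
  Choosing such a decomposition for each slice and pulling the factors back along \<open>L\<close> yields \<open>P\<close>,
  \<open>\<Phi>\<close> and, if the core blocks have a common size, the tensors of the second part.

  The remaining point is the exponent in the definition of the Drazin inverse of a tensor, which is
  the index of the large Toeplitz-plus-Hankel matrix and not of a slice. A matrix \<open>B\<close> of index \<open>k\<close>
  satisfies \<open>B\<^sup>k\<^sup>+\<^sup>1 Y = B\<^sup>k\<close> for some \<open>Y\<close> (\<open>mindex_factor\<close>), and this equation is all that is needed for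
  the nilpotent block to satisfy \<open>N\<^sup>k = 0\<close> (\<open>nilpotent_pow_zero\<close>). It passes from the large matrix to
  each slice, because the sampled cosines of the DCT are left block eigenvectors of the
  Toeplitz-plus-Hankel matrix, with the slices of \<open>L(A)\<close> as the matrix-valued eigenvalues
  (\<open>block_wave_tmat\<close>, \<open>L_trans_tindex_factor\<close>).
\<close>

section \<open>Core-nilpotent decomposition and Drazin inverse\<close>

text \<open>
  A symmetric relation that carries the size along, so that inverses can be passed on without
  first establishing that \<open>minv\<close> denotes one.
\<close>

definition inverse_pair :: "nat \<Rightarrow> complex mat \<Rightarrow> complex mat \<Rightarrow> bool" where
  "inverse_pair n A B \<longleftrightarrow> A \<in> carrier_mat n n \<and> B \<in> carrier_mat n n \<and> A * B = 1\<^sub>m n \<and> B * A = 1\<^sub>m n"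

lemma inverse_pairD:
  assumes "inverse_pair n A B"
  shows "A \<in> carrier_mat n n" "B \<in> carrier_mat n n" "A * B = 1\<^sub>m n" "B * A = 1\<^sub>m n"
  using assms by (auto simp: inverse_pair_def)

lemma inverse_pair_sym: "inverse_pair n A B \<Longrightarrow> inverse_pair n B A"
  by (auto simp: inverse_pair_def)

lemma inverse_pair_invertible_mat: "inverse_pair n A B \<Longrightarrow> invertible_mat A"
  by (auto simp: inverse_pair_def invertible_mat_def inverts_mat_def intro!: exI[of _ B])

lemma inverse_pair_of_det:
  assumes "A \<in> carrier_mat n n" "det A \<noteq> 0"
  shows "\<exists>B. inverse_pair n A B"
  using det_non_zero_imp_unit[OF assms, of "()"] assms(1)
  by (auto simp: inverse_pair_def Units_def ring_mat_def)

lemma det_of_inverse_pair: "inverse_pair n A B \<Longrightarrow> det A \<noteq> 0"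
  using det_mult[of A n B] by (auto simp: inverse_pair_def)

lemma minv_eq:
  assumes "inverse_pair n A B"
  shows "minv A = B"
proof -
  note AB = inverse_pairD[OF assms]
  have "A \<in> Units (ring_mat TYPE(complex) n ())"
    using AB by (auto simp: Units_def ring_mat_def)
  then obtain B' where B': "mat_inverse A = Some B'"
    using mat_inverse(1)[OF AB(1), where b = "()"] by (cases "mat_inverse A") auto
  from mat_inverse(2)[OF AB(1) B'] have AB': "A * B' = 1\<^sub>m n" "B' \<in> carrier_mat n n" by auto
  have "B' = B * A * B'" using AB AB' by simp
  also have "\<dots> = B * (A * B')" by (rule assoc_mult_mat[OF AB(2,1) AB'(2)])
  also have "\<dots> = B" using AB AB' by simp
  finally show ?thesis by (simp add: minv_def B')
qed

lemma mrank_invertible: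
  assumes "inverse_pair n A B"
  shows "mrank A = n"
  using vec_space.low_rank_det_zero[OF inverse_pairD(1)[OF assms] det_of_inverse_pair[OF assms]]
    inverse_pairD(1)[OF assms]
  by (simp add: mrank_def)

abbreviation bdiag :: "'a::zero mat \<Rightarrow> 'a mat \<Rightarrow> 'a mat" (infixr "\<oplus>\<^sub>d" 66) where
  "A \<oplus>\<^sub>d B \<equiv> four_block_mat A (0\<^sub>m (dim_row A) (dim_col B)) (0\<^sub>m (dim_row B) (dim_col A)) B"

lemma bdiag_mult:
  fixes A B C D :: "'a::semiring_1 mat"
  assumes "A \<in> carrier_mat n n" "B \<in> carrier_mat m m" "C \<in> carrier_mat n n" "D \<in> carrier_mat m m"
  shows "(A \<oplus>\<^sub>d B) * (C \<oplus>\<^sub>d D) = (A * C) \<oplus>\<^sub>d (B * D)"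
  using assms by (subst mult_four_block_mat[of _ n n _ m _ m _ _ n _ m]) auto

lemma bdiag_pow:
  fixes A B :: "'a::semiring_1 mat"
  assumes "A \<in> carrier_mat n n" "B \<in> carrier_mat m m"
  shows "(A \<oplus>\<^sub>d B) ^\<^sub>m k = (A ^\<^sub>m k) \<oplus>\<^sub>d (B ^\<^sub>m k)"
  using pow_four_block_mat[OF assms, of k] assms by simp

lemma bdiag_right_cancel:
  assumes "A \<oplus>\<^sub>d B = C \<oplus>\<^sub>d D" "A \<in> carrier_mat n n" "C \<in> carrier_mat n n"
    "B \<in> carrier_mat m m" "D \<in> carrier_mat m m"
  shows "B = D"
proof (rule eq_matI)
  fix i j assume ij: "i < dim_row D" "j < dim_col D"
  have "(A \<oplus>\<^sub>d B) $$ (n + i, n + j) = (C \<oplus>\<^sub>d D) $$ (n + i, n + j)" by (simp only: assms(1))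
  then show "B $$ (i, j) = D $$ (i, j)" using ij assms(2-) by simp
qed (use assms in auto)

lemma bdiag_inverse_pair:
  assumes "inverse_pair n A B" "inverse_pair m C D"
  shows "inverse_pair (n + m) (A \<oplus>\<^sub>d C) (B \<oplus>\<^sub>d D)"
proof -
  note A = inverse_pairD[OF assms(1)] and C = inverse_pairD[OF assms(2)]
  have "(A \<oplus>\<^sub>d C) * (B \<oplus>\<^sub>d D) = 1\<^sub>m (n + m)" "(B \<oplus>\<^sub>d D) * (A \<oplus>\<^sub>d C) = 1\<^sub>m (n + m)"
    using bdiag_mult[OF A(1) C(1) A(2) C(2)] bdiag_mult[OF A(2) C(2) A(1) C(1)]
    by (simp_all only: A C index_one_mat four_block_one_mat)
  then show ?thesis using A C by (simp add: inverse_pair_def)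
qed

lemma pow_mat_add:
  fixes A :: "'a::semiring_1 mat"
  assumes A: "A \<in> carrier_mat n n"
  shows "A ^\<^sub>m (i + j) = A ^\<^sub>m i * A ^\<^sub>m j"
proof (induction j)
  case (Suc j)
  have "A ^\<^sub>m i \<in> carrier_mat n n" "A ^\<^sub>m j \<in> carrier_mat n n" using A by auto
  from assoc_mult_mat[OF this A] show ?case using Suc.IH by simp
qed (use A in simp)

text \<open>
  Exchanging the two groups of coordinates is a change of basis. This is what allows the Jordan
  blocks to be sorted.
\<close>

lemma similar_bdiag_swap:
  fixes A B :: "'a::comm_ring_1 mat"
  assumes A: "A \<in> carrier_mat n n" and B: "B \<in> carrier_mat m m"
  shows "similar_mat (A \<oplus>\<^sub>d B) (B \<oplus>\<^sub>d A)"
proof -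
  \<comment> \<open>The block permutation matrix exchanging the first \<open>n\<close> coordinates with the last \<open>m\<close>.\<close>
  let ?P = "four_block_mat (0\<^sub>m n m) (1\<^sub>m n) (1\<^sub>m m) (0\<^sub>m m n) :: 'a mat"
  let ?Q = "four_block_mat (0\<^sub>m m n) (1\<^sub>m m) (1\<^sub>m n) (0\<^sub>m n m) :: 'a mat"
  have "?P * ?Q = 1\<^sub>m (n + m)"
    by (subst mult_four_block_mat[of _ n m _ n _ m _ _ n _ m]) auto
  moreover have "?Q * ?P = 1\<^sub>m (n + m)"
    by (subst mult_four_block_mat[of _ m n _ m _ n _ _ m _ n]) (auto simp: add.commute)
  moreover have PB: "?P * (B \<oplus>\<^sub>d A) = four_block_mat (0\<^sub>m n m) A B (0\<^sub>m m n)"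
    using A B by (subst mult_four_block_mat[of _ n m _ n _ m _ _ m _ n]) auto
  have "A \<oplus>\<^sub>d B = ?P * (B \<oplus>\<^sub>d A) * ?Q"
    unfolding PB using A B by (subst mult_four_block_mat[of _ n m _ n _ m _ _ n _ m]) auto
  ultimately show ?thesis
    using A B by (intro similar_matI[of _ _ ?P ?Q "n + m"]) (auto simp: add.commute)
qed

lemma similar_bdiag_cong:
  assumes "similar_mat B B'" "A \<in> carrier_mat n n"
  shows "similar_mat (A \<oplus>\<^sub>d B) (A \<oplus>\<^sub>d B')"
proof -
  from similar_matD[OF assms(1)] obtain m where "B \<in> carrier_mat m m" "B' \<in> carrier_mat m m" by auto
  then show ?thesis
    using similar_mat_four_block_0_0[OF similar_mat_refl[OF assms(2)] assms(1,2), of m] assms(2) by simp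
qed

lemma jordan_block_inverse_pair:
  assumes "a \<noteq> 0"
  shows "\<exists>B. inverse_pair n (jordan_block n a) B"
proof (rule inverse_pair_of_det)
  have "det (jordan_block n a) = prod_list (diag_mat (jordan_block n a))"
    by (rule det_upper_triangular[of _ n]) auto
  also have "\<dots> = a ^ n" by (simp add: prod_list_diag_prod)
  finally show "det (jordan_block n a) \<noteq> 0" using assms by simp
qed simp

text \<open>
  Adding one block at a time: a block with nonzero eigenvalue joins the invertible part directly,
  a block with eigenvalue zero is nilpotent and is first moved behind the invertible part.
\<close>

lemma jordan_matrix_core_nilpotent:
  "\<exists>s t C D N e. s + t = sum_list (map fst n_as) \<and> inverse_pair s C D \<and>
     N \<in> carrier_mat t t \<and> N ^\<^sub>m e = 0\<^sub>m t t \<and> similar_mat (jordan_matrix n_as) (C \<oplus>\<^sub>d N)"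
proof (induction n_as)
  case Nil
  have "jordan_matrix [] = (0\<^sub>m 0 0 :: complex mat)" by (auto intro!: eq_matI)
  moreover have "0\<^sub>m 0 0 \<oplus>\<^sub>d 0\<^sub>m 0 0 = (0\<^sub>m 0 0 :: complex mat)" by (auto intro!: eq_matI)
  ultimately have "similar_mat (jordan_matrix []) (0\<^sub>m 0 0 \<oplus>\<^sub>d (0\<^sub>m 0 0 :: complex mat))"
    by (simp only: similar_mat_refl[of _ 0] zero_carrier_mat)
  moreover have "inverse_pair 0 (0\<^sub>m 0 0) (0\<^sub>m 0 0)" by (auto simp: inverse_pair_def)
  ultimately show ?case
    by (intro exI[of _ 0] exI[of _ "0\<^sub>m 0 0"] exI[of _ 1]) auto
next
  case (Cons na n_as)
  obtain n a where na: "na = (n, a)" by force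
  let ?J = "jordan_block n a"
  from Cons.IH obtain s t C D N e where IH: "s + t = sum_list (map fst n_as)" "inverse_pair s C D"
    "N \<in> carrier_mat t t" "N ^\<^sub>m e = 0\<^sub>m t t" "similar_mat (jordan_matrix n_as) (C \<oplus>\<^sub>d N)"
    by blast
  note C = inverse_pairD[OF IH(2)]
  have "jordan_matrix (na # n_as) = ?J \<oplus>\<^sub>d jordan_matrix n_as"
    by (simp add: na jordan_matrix_Cons)
  then have sim: "similar_mat (jordan_matrix (na # n_as)) (?J \<oplus>\<^sub>d (C \<oplus>\<^sub>d N))"
    using similar_bdiag_cong[OF IH(5), of ?J n] by simp
  show ?case
  proof (cases "a = 0")
    case False
    then obtain J' where J': "inverse_pair n ?J J'" using jordan_block_inverse_pair by blast
    have "?J \<oplus>\<^sub>d (C \<oplus>\<^sub>d N) = (?J \<oplus>\<^sub>d C) \<oplus>\<^sub>d N" by (rule assoc_four_block_mat)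
    with sim have "similar_mat (jordan_matrix (na # n_as)) ((?J \<oplus>\<^sub>d C) \<oplus>\<^sub>d N)" by simp
    with bdiag_inverse_pair[OF J' IH(2)] IH(1,3,4) show ?thesis
      by (intro exI[of _ "n + s"] exI[of _ t] exI[of _ "?J \<oplus>\<^sub>d C"] exI[of _ "J' \<oplus>\<^sub>d D"]
          exI[of _ N] exI[of _ e]) (simp add: na)
  next
    case True
    have "similar_mat (?J \<oplus>\<^sub>d (C \<oplus>\<^sub>d N)) ((C \<oplus>\<^sub>d N) \<oplus>\<^sub>d ?J)"
      using C IH(3) by (intro similar_bdiag_swap[of _ n _ "s + t"]) auto
    moreover have "(C \<oplus>\<^sub>d N) \<oplus>\<^sub>d ?J = C \<oplus>\<^sub>d (N \<oplus>\<^sub>d ?J)" by (rule assoc_four_block_mat[symmetric])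
    ultimately have "similar_mat (jordan_matrix (na # n_as)) (C \<oplus>\<^sub>d (N \<oplus>\<^sub>d ?J))"
      using similar_mat_trans[OF sim] by simp
    moreover have "(N \<oplus>\<^sub>d ?J) ^\<^sub>m (e + n) = 0\<^sub>m (t + n) (t + n)"
    proof -
      have "N ^\<^sub>m (e + n) = 0\<^sub>m t t"
        using IH(3,4) by (simp add: pow_mat_add[OF IH(3)])
      moreover have "?J ^\<^sub>m (e + n) = 0\<^sub>m n n"
        unfolding True jordan_block_zero_pow by (auto intro!: eq_matI)
      ultimately show ?thesis
        unfolding bdiag_pow[OF IH(3) jordan_block_carrier] by simp
    qed
    ultimately show ?thesis using IH(1-3)
      by (intro exI[of _ s] exI[of _ "t + n"] exI[of _ C] exI[of _ D]
          exI[of _ "N \<oplus>\<^sub>d ?J"] exI[of _ "e + n"]) (simp add: na)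
  qed
qed

text \<open>
  \<open>Q\<close> and \<open>D\<close> are the inverses of \<open>P\<close> and \<open>C\<close>. The nilpotency exponent is left open here; a bound on
  it is a separate matter that depends on the index.
\<close>

definition core_nilpotent_form ::
  "nat \<Rightarrow> complex mat \<Rightarrow> complex mat \<Rightarrow> complex mat \<Rightarrow> nat \<Rightarrow> complex mat \<Rightarrow> complex mat \<Rightarrow> nat \<Rightarrow>
    complex mat \<Rightarrow> bool" where
  "core_nilpotent_form n A P Q s C D t N \<longleftrightarrow> s + t = n \<and> inverse_pair n P Q \<and> inverse_pair s C D \<and>
     N \<in> carrier_mat t t \<and> (\<exists>e. N ^\<^sub>m e = 0\<^sub>m t t) \<and> A = P * (C \<oplus>\<^sub>d N) * Q"

lemma core_nilpotent_form_exists: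
  assumes A: "A \<in> carrier_mat n n"
  shows "\<exists>P Q s C D t N. core_nilpotent_form n A P Q s C D t N"
proof -
  from char_poly_factorized[OF A] obtain as where "char_poly A = (\<Prod>a\<leftarrow>as. [:- a, 1:])" by auto
  from jordan_nf_exists[OF A this] obtain n_as where J: "similar_mat A (jordan_matrix n_as)"
    by (auto simp: jordan_nf_def)
  from similar_matD[OF this] A have n: "sum_list (map fst n_as) = n"
    by (metis carrier_matD(1) jordan_matrix_dim(1) insert_subset)
  obtain s t C D N e where d: "s + t = n" "inverse_pair s C D"
     "N \<in> carrier_mat t t" "N ^\<^sub>m e = 0\<^sub>m t t" "similar_mat (jordan_matrix n_as) (C \<oplus>\<^sub>d N)"
    using jordan_matrix_core_nilpotent[of n_as] unfolding n by blast
  from similar_mat_trans[OF J d(5)] obtain P Q where "similar_mat_wit A (C \<oplus>\<^sub>d N) P Q"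
    by (auto simp: similar_mat_def)
  from similar_mat_witD2[OF A this] d show ?thesis
    unfolding core_nilpotent_form_def inverse_pair_def by blast
qed

lemma conj_mult:
  fixes P Q S T :: "'a::semiring_1 mat"
  assumes "Q * P = 1\<^sub>m n" "P \<in> carrier_mat n n" "Q \<in> carrier_mat n n"
    "S \<in> carrier_mat n n" "T \<in> carrier_mat n n"
  shows "(P * S * Q) * (P * T * Q) = P * (S * T) * Q"
proof -
  have "(P * S * Q) * (P * T * Q) = P * S * (Q * P) * (T * Q)"
    using assms(2-) by (simp add: assoc_mult_mat[of _ n n _ n _ n])
  then show ?thesis using assms by (simp add: assoc_mult_mat[of _ n n _ n _ n])
qed

lemma conj_inverse_pair_cancel:
  assumes "inverse_pair n P Q" "S \<in> carrier_mat n n"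
  shows "Q * (P * S * Q) * P = S"
proof -
  note P = inverse_pairD[OF assms(1)]
  have "Q * (P * S * Q) * P = (Q * P) * S * (Q * P)"
    using P(1,2) assms(2) by (simp add: assoc_mult_mat[of _ n n _ n _ n])
  then show ?thesis using P assms(2) by simp
qed

text \<open>
  The exponent \<open>k\<close> is a parameter of its own, since for a slice of a tensor it is the index of the
  tensor, which may exceed that of the slice.
\<close>

definition is_drazin :: "nat \<Rightarrow> complex mat \<Rightarrow> complex mat \<Rightarrow> bool" where
  "is_drazin k A X \<longleftrightarrow> A ^\<^sub>m (k + 1) * X = A ^\<^sub>m k \<and> X * A * X = X \<and> A * X = X * A"

lemma pow_mat_commute:
  fixes A X :: "'a::semiring_1 mat"
  assumes A: "A \<in> carrier_mat n n" and X: "X \<in> carrier_mat n n" and "A * X = X * A"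
  shows "A ^\<^sub>m k * X = X * A ^\<^sub>m k"
proof (induction k)
  case (Suc k)
  have p: "A ^\<^sub>m k \<in> carrier_mat n n" using A by simp
  have "A ^\<^sub>m Suc k * X = A ^\<^sub>m k * (A * X)" using assoc_mult_mat[OF p A X] by simp
  also have "\<dots> = A ^\<^sub>m k * X * A" using assoc_mult_mat[OF p X A] assms(3) by simp
  also have "\<dots> = X * A ^\<^sub>m Suc k" using assoc_mult_mat[OF X p A] Suc.IH by simp
  finally show ?case .
qed (use assms in simp)

text \<open>
  Since \<open>X = X A X\<close> and \<open>A\<close>, \<open>X\<close> commute, further factors \<open>A X\<close> may be inserted into \<open>X\<close> at will.
\<close>

lemma drazin_pow_absorb:
  fixes A X :: "'a::semiring_1 mat"
  assumes A: "A \<in> carrier_mat n n" and X: "X \<in> carrier_mat n n"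
    and XAX: "X * A * X = X" and comm: "A * X = X * A"
  shows "X = A ^\<^sub>m k * X ^\<^sub>m (k + 1)" "X = X ^\<^sub>m (k + 1) * A ^\<^sub>m k"
proof -
  note assoc = assoc_mult_mat[of _ n n _ n _ n] mult_carrier_mat[of _ n n _ n]
  have p: "A ^\<^sub>m k \<in> carrier_mat n n" "X ^\<^sub>m k \<in> carrier_mat n n" for k using A X by auto
  have c: "X ^\<^sub>m k * A = A * X ^\<^sub>m k" for k by (rule pow_mat_commute[OF X A comm[symmetric]])
  have main: "A ^\<^sub>m k * X ^\<^sub>m (k + 1) = X" for k
  proof (induction k)
    case (Suc k)
    have "A ^\<^sub>m Suc k * X ^\<^sub>m (Suc k + 1) = A ^\<^sub>m k * (A * X ^\<^sub>m (k + 1)) * X"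
      using A X p by (simp add: assoc)
    also have "\<dots> = (A ^\<^sub>m k * X ^\<^sub>m (k + 1)) * A * X"
      unfolding c[symmetric] using A X p[of k] p[of "k + 1"] by (simp only: assoc mult_carrier_mat)
    finally show ?case using Suc.IH XAX by simp
  qed (use A X in simp)
  then show "X = A ^\<^sub>m k * X ^\<^sub>m (k + 1)" by simp
  have "A ^\<^sub>m k * X ^\<^sub>m (k + 1) = X ^\<^sub>m (k + 1) * A ^\<^sub>m k"
    by (rule pow_mat_commute[OF A p(2) c[symmetric]])
  with main[of k] show "X = X ^\<^sub>m (k + 1) * A ^\<^sub>m k" by simp
qed

text \<open>
  Both solutions equal \<open>X A Y\<close>: write \<open>X = X\<^sup>k\<^sup>+\<^sup>1 A\<^sup>k\<close> and replace \<open>A\<^sup>k\<close> by \<open>A\<^sup>k\<^sup>+\<^sup>1 Y\<close>, and symmetrically write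
  \<open>Y = A\<^sup>k Y\<^sup>k\<^sup>+\<^sup>1\<close> and replace \<open>A\<^sup>k\<close> by \<open>X A\<^sup>k\<^sup>+\<^sup>1\<close>.
\<close>

lemma is_drazin_unique:
  assumes A: "A \<in> carrier_mat n n" and X: "X \<in> carrier_mat n n" and Y: "Y \<in> carrier_mat n n"
    and dX: "is_drazin k A X" and dY: "is_drazin k A Y"
  shows "X = Y"
proof -
  note assoc = assoc_mult_mat[of _ n n _ n _ n] mult_carrier_mat[of _ n n _ n]
  have p: "A ^\<^sub>m k \<in> carrier_mat n n" "X ^\<^sub>m k \<in> carrier_mat n n" "Y ^\<^sub>m k \<in> carrier_mat n n" for k
    using A X Y by auto
  note [simp] = p[of k] p[of "k + 1"] p[of "Suc k"] A X Y
  from dX dY have eqs: "X * A * X = X" "A * X = X * A" "Y * A * Y = Y" "A * Y = Y * A"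
    "A ^\<^sub>m (k + 1) * X = A ^\<^sub>m k" "A ^\<^sub>m (k + 1) * Y = A ^\<^sub>m k"
    by (auto simp: is_drazin_def)
  note aX = drazin_pow_absorb[OF A X eqs(1,2), of k] and aY = drazin_pow_absorb[OF A Y eqs(3,4), of k]
  have "X = X ^\<^sub>m (k + 1) * (A ^\<^sub>m (k + 1) * Y)" using aX(2) eqs(6) by simp
  also have "\<dots> = X ^\<^sub>m (k + 1) * A ^\<^sub>m k * (A * Y)" by (simp add: assoc)
  also have "\<dots> = X * (A * Y)" by (simp only: aX(2)[symmetric])
  finally have 1: "X = X * (A * Y)" .
  have "Y = (A ^\<^sub>m (k + 1) * X) * Y ^\<^sub>m (k + 1)" using aY(1) eqs(5) by simp
  also have "A ^\<^sub>m (k + 1) * X = X * A ^\<^sub>m (k + 1)" by (rule pow_mat_commute[OF A X eqs(2)])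
  also have "A ^\<^sub>m (k + 1) = A * A ^\<^sub>m k" using pow_mat_commute[OF A A refl, of k] by simp
  also have "X * (A * A ^\<^sub>m k) * Y ^\<^sub>m (k + 1) = X * (A * (A ^\<^sub>m k * Y ^\<^sub>m (k + 1)))"
    using mult_carrier_mat[OF A p(1)[of k]] mult_carrier_mat[OF p(1)[of k] p(3)[of "k+1"]]
    by (simp only: assoc A X p)
  also have "\<dots> = X * (A * Y)" by (simp only: aY(1)[symmetric])
  finally show ?thesis using 1 by simp
qed

lemma core_nilpotent_form_pow:
  assumes "core_nilpotent_form n A P Q s C D t N"
  shows "A ^\<^sub>m k = P * (C ^\<^sub>m k \<oplus>\<^sub>d N ^\<^sub>m k) * Q"
proof -
  from assms have c: "s + t = n" "inverse_pair n P Q" "inverse_pair s C D" "N \<in> carrier_mat t t"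
    "A = P * (C \<oplus>\<^sub>d N) * Q" by (auto simp: core_nilpotent_form_def)
  note P = inverse_pairD[OF c(2)] and C = inverse_pairD[OF c(3)]
  have "similar_mat_wit A (C \<oplus>\<^sub>d N) P Q"
    using c P C by (intro similar_mat_witI[of P Q n]) auto
  from similar_mat_wit_pow_id[OF this, of k] show ?thesis
    by (simp only: bdiag_pow[OF C(1) c(4)])
qed

lemma pow_eq_telescope:
  fixes A Y :: "'a::semiring_1 mat"
  assumes A: "A \<in> carrier_mat n n" and Y: "Y \<in> carrier_mat n n"
    and eq: "A ^\<^sub>m (k + 1) * Y = A ^\<^sub>m k"
  shows "A ^\<^sub>m k = A ^\<^sub>m (j + k) * Y ^\<^sub>m j"
proof (induction j)
  case (Suc j)
  note assoc = assoc_mult_mat[of _ n n _ n _ n] mult_carrier_mat[of _ n n _ n]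
  have p: "A ^\<^sub>m k \<in> carrier_mat n n" "Y ^\<^sub>m k \<in> carrier_mat n n" for k using A Y by auto
  have YY: "Y ^\<^sub>m Suc j = Y * Y ^\<^sub>m j" using pow_mat_commute[OF Y Y refl, of j] by simp
  have "A ^\<^sub>m (Suc j + k) * Y ^\<^sub>m Suc j = A ^\<^sub>m j * A ^\<^sub>m (k + 1) * (Y * Y ^\<^sub>m j)"
    unfolding YY using pow_mat_add[OF A, of j "k + 1"] by simp
  also have "\<dots> = A ^\<^sub>m j * (A ^\<^sub>m (k + 1) * Y) * Y ^\<^sub>m j"
    using p[of j] p[of "k + 1"] Y by (simp only: assoc mult_carrier_mat)
  also have "\<dots> = A ^\<^sub>m k"
    using Suc.IH pow_mat_add[OF A, of j k] by (simp only: eq)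
  finally show ?case by simp
qed (use A Y in simp)

text \<open>
  Iterating the hypothesis gives \<open>A\<^sup>k = A\<^sup>e\<^sup>+\<^sup>k Y\<^sup>e\<close>. For large \<open>e\<close> the power \<open>A\<^sup>e\<^sup>+\<^sup>k\<close> has no nilpotent block
  left, hence neither has \<open>A\<^sup>k\<close>.
\<close>

lemma nilpotent_pow_zero:
  assumes dec: "core_nilpotent_form n A P Q s C D t N" and Y: "Y \<in> carrier_mat n n"
    and eq: "A ^\<^sub>m (k + 1) * Y = A ^\<^sub>m k"
  shows "N ^\<^sub>m k = 0\<^sub>m t t"
proof -
  from dec obtain e where c: "s + t = n" "inverse_pair n P Q" "inverse_pair s C D" "N \<in> carrier_mat t t"
    "N ^\<^sub>m e = 0\<^sub>m t t" "A = P * (C \<oplus>\<^sub>d N) * Q" by (auto simp: core_nilpotent_form_def)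
  note P = inverse_pairD[OF c(2)] and C = inverse_pairD[OF c(3)]
  note assoc = assoc_mult_mat[of _ n n _ n _ n] mult_carrier_mat[of _ n n _ n]
  have A: "A \<in> carrier_mat n n" using c P C by auto
  define Z where "Z = Q * Y ^\<^sub>m e * P"
  have Z: "Z \<in> carrier_mat n n" using P Y by (simp add: Z_def assoc)
  \<comment> \<open>Projection onto the last \<open>t\<close> coordinates; it kills the core block.\<close>
  define E where "E = 0\<^sub>m s s \<oplus>\<^sub>d (1\<^sub>m t :: complex mat)"
  have Nek: "N ^\<^sub>m (e + k) = 0\<^sub>m t t" using c(4,5) by (simp add: pow_mat_add[OF c(4)])
  define S where "S = (\<lambda>m. C ^\<^sub>m m \<oplus>\<^sub>d N ^\<^sub>m m)"
  have S: "S m \<in> carrier_mat n n" for m using C c(1,4) by (auto simp: S_def)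
  have E: "E \<in> carrier_mat n n" using c(1) by (auto simp: E_def)
  have ApS: "A ^\<^sub>m m = P * S m * Q" for m
    using core_nilpotent_form_pow[OF dec] by (simp add: S_def)
  have "S k = Q * (P * S k * Q) * P" by (rule conj_inverse_pair_cancel[OF c(2) S, symmetric])
  also have "P * S k * Q = P * S (e + k) * Q * Y ^\<^sub>m e"
    using pow_eq_telescope[OF A Y eq, of e] by (simp only: ApS)
  also have "Q * (P * S (e + k) * Q * Y ^\<^sub>m e) * P = (Q * P) * S (e + k) * Z"
    using P(1,2) S Y by (simp add: assoc Z_def)
  finally have Sk: "S k = S (e + k) * Z" by (simp only: P(4) left_mult_one_mat[OF S])
  have ES: "E * S m = 0\<^sub>m s s \<oplus>\<^sub>d N ^\<^sub>m m" for m
    unfolding E_def S_def using C c(4) by (subst bdiag_mult[of _ s _ t]) auto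
  have "0\<^sub>m s s \<oplus>\<^sub>d N ^\<^sub>m k = E * S (e + k) * Z"
    unfolding assoc(1)[OF E S Z] Sk[symmetric] by (rule ES[symmetric])
  also have "E * S (e + k) = 0\<^sub>m n n" unfolding ES Nek using c(1) by simp
  finally have "0\<^sub>m s s \<oplus>\<^sub>d N ^\<^sub>m k = 0\<^sub>m s s \<oplus>\<^sub>d 0\<^sub>m t t" using Z c(1) by simp
  from bdiag_right_cancel[OF this, of s t] show ?thesis using c(4) by auto
qed

lemma core_nilpotent_form_drazin:
  assumes dec: "core_nilpotent_form n A P Q s C D t N" and Nk: "N ^\<^sub>m k = 0\<^sub>m t t"
  shows "is_drazin k A (P * (D \<oplus>\<^sub>d 0\<^sub>m t t) * Q)"
proof -
  from dec have c: "s + t = n" "inverse_pair n P Q" "inverse_pair s C D" "N \<in> carrier_mat t t"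
    "A = P * (C \<oplus>\<^sub>d N) * Q" by (auto simp: core_nilpotent_form_def)
  note P = inverse_pairD[OF c(2)] and C = inverse_pairD[OF c(3)]
  note ApS = core_nilpotent_form_pow[OF dec]
  have N1: "N ^\<^sub>m (k + 1) = 0\<^sub>m t t" using Nk c(4) by simp
  have carr: "U \<oplus>\<^sub>d V \<in> carrier_mat n n" if "U \<in> carrier_mat s s" "V \<in> carrier_mat t t"
    for U V :: "complex mat" using that c(1) by auto
  have conj: "(P * (U \<oplus>\<^sub>d V) * Q) * (P * (U' \<oplus>\<^sub>d V') * Q) = P * ((U * U') \<oplus>\<^sub>d (V * V')) * Q"
    if "U \<in> carrier_mat s s" "V \<in> carrier_mat t t" "U' \<in> carrier_mat s s" "V' \<in> carrier_mat t t"
    for U V U' V' :: "complex mat"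
    using conj_mult[OF P(4,1,2) carr[OF that(1,2)] carr[OF that(3,4)]]
    by (simp add: bdiag_mult[OF that])
  define X where "X = P * (D \<oplus>\<^sub>d 0\<^sub>m t t) * Q"
  have z: "0\<^sub>m t t \<in> carrier_mat t t" by simp
  have p: "C ^\<^sub>m m \<in> carrier_mat s s" "N ^\<^sub>m m \<in> carrier_mat t t" for m using C c(4) by auto
  have AmX: "A ^\<^sub>m m * X = P * ((C ^\<^sub>m m * D) \<oplus>\<^sub>d 0\<^sub>m t t) * Q" for m
    unfolding ApS X_def conj[OF p C(2) z] by (simp only: right_mult_zero_mat[OF p(2)])
  have XA: "X * A = P * (1\<^sub>m s \<oplus>\<^sub>d 0\<^sub>m t t) * Q"
    unfolding X_def c(5) conj[OF C(2) z C(1) c(4)] by (simp only: C(4) left_mult_zero_mat[OF c(4)])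
  have AX: "A * X = P * (1\<^sub>m s \<oplus>\<^sub>d 0\<^sub>m t t) * Q"
    unfolding X_def c(5) conj[OF C(1) c(4) C(2) z] by (simp only: C(3) right_mult_zero_mat[OF c(4)])
  have XAX: "X * A * X = X"
    unfolding XA unfolding X_def conj[OF one_carrier_mat z C(2) z]
    by (simp only: left_mult_one_mat[OF C(2)] left_mult_zero_mat[OF z])
  have "C ^\<^sub>m (k + 1) * D = C ^\<^sub>m k * (C * D)"
    using assoc_mult_mat[OF p(1) C(1,2)] by simp
  then have CD: "C ^\<^sub>m (k + 1) * D = C ^\<^sub>m k" using right_mult_one_mat[OF p(1)] by (simp only: C(3))
  have "A ^\<^sub>m (k + 1) * X = A ^\<^sub>m k"
    by (simp only: AmX CD ApS[of k] Nk)
  then show ?thesis using XAX AX XA by (simp only: is_drazin_def X_def[symmetric])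
qed

lemma core_nilpotent_form_parts:
  assumes dec: "core_nilpotent_form n A P Q s C D t N" and A: "A \<in> carrier_mat n n"
    and Y: "Y \<in> carrier_mat n n" and eq: "A ^\<^sub>m (mindex A + 1) * Y = A ^\<^sub>m mindex A"
  shows "core_part A = P * (C \<oplus>\<^sub>d 0\<^sub>m t t) * Q"
    and "nilpotent_part A = P * (0\<^sub>m s s \<oplus>\<^sub>d N) * Q"
proof -
  from dec have c: "s + t = n" "inverse_pair n P Q" "inverse_pair s C D" "N \<in> carrier_mat t t"
    "A = P * (C \<oplus>\<^sub>d N) * Q" by (auto simp: core_nilpotent_form_def)
  note P = inverse_pairD[OF c(2)] and C = inverse_pairD[OF c(3)]
  have carr: "U \<oplus>\<^sub>d V \<in> carrier_mat n n" if "U \<in> carrier_mat s s" "V \<in> carrier_mat t t"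
    for U V :: "complex mat" using that c(1) by auto
  define X where "X = P * (D \<oplus>\<^sub>d 0\<^sub>m t t) * Q"
  have X: "X \<in> carrier_mat n n" using P C c(1) by (auto simp: X_def)
  have dX: "is_drazin (mindex A) A X"
    unfolding X_def by (rule core_nilpotent_form_drazin[OF dec nilpotent_pow_zero[OF dec Y eq]])
  have "mdrazin A = X"
    unfolding mdrazin_def
  proof (rule the_equality)
    show "X \<in> carrier_mat (dim_row A) (dim_row A) \<and> A ^\<^sub>m (mindex A + 1) * X = A ^\<^sub>m mindex A \<and>
        X * A * X = X \<and> A * X = X * A"
      using A X dX unfolding is_drazin_def by (metis carrier_matD(1))
  next
    fix Z assume "Z \<in> carrier_mat (dim_row A) (dim_row A) \<and> A ^\<^sub>m (mindex A + 1) * Z = A ^\<^sub>m mindex A \<and>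
        Z * A * Z = Z \<and> A * Z = Z * A"
    then have "Z \<in> carrier_mat n n" "is_drazin (mindex A) A Z"
      using A by (auto simp: is_drazin_def simp del: pow_mat.simps)
    then show "Z = X" using is_drazin_unique[OF A _ X _ dX] by blast
  qed
  then have "core_part A = A ^\<^sub>m 2 * X" by (simp add: core_part_def)
  also have "\<dots> = P * ((C ^\<^sub>m 2 * D) \<oplus>\<^sub>d 0\<^sub>m t t) * Q"
    unfolding core_nilpotent_form_pow[OF dec] X_def using P C c(4)
      conj_mult[OF P(4,1,2) carr carr, of "C ^\<^sub>m 2" "N ^\<^sub>m 2" D "0\<^sub>m t t"]
      bdiag_mult[of "C ^\<^sub>m 2" s "N ^\<^sub>m 2" t D "0\<^sub>m t t"] by simp
  also have "C ^\<^sub>m 2 * D = C"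
    using C by (simp add: numeral_2_eq_2 assoc_mult_mat[of _ s s _ s _ s])
  finally show core: "core_part A = P * (C \<oplus>\<^sub>d 0\<^sub>m t t) * Q" .
  have split: "C \<oplus>\<^sub>d N = (C \<oplus>\<^sub>d 0\<^sub>m t t) + (0\<^sub>m s s \<oplus>\<^sub>d N)"
    using C c(4) by (intro eq_matI) auto
  have c0: "C \<oplus>\<^sub>d 0\<^sub>m t t \<in> carrier_mat n n" "0\<^sub>m s s \<oplus>\<^sub>d N \<in> carrier_mat n n"
    using carr[OF C(1), of "0\<^sub>m t t"] carr[OF _ c(4), of "0\<^sub>m s s"] by simp_all
  have "A = P * (C \<oplus>\<^sub>d 0\<^sub>m t t) * Q + P * (0\<^sub>m s s \<oplus>\<^sub>d N) * Q"
    unfolding c(5) split mult_add_distrib_mat[OF P(1) c0]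
    by (rule add_mult_distrib_mat[OF mult_carrier_mat[OF P(1) c0(1)] mult_carrier_mat[OF P(1) c0(2)] P(2)])
  then have "nilpotent_part A = P * (C \<oplus>\<^sub>d 0\<^sub>m t t) * Q + P * (0\<^sub>m s s \<oplus>\<^sub>d N) * Q - P * (C \<oplus>\<^sub>d 0\<^sub>m t t) * Q"
    unfolding nilpotent_part_def core by (rule arg_cong)
  also have "\<dots> = P * (0\<^sub>m s s \<oplus>\<^sub>d N) * Q"
    by (intro eq_matI) (use P in auto)
  finally show "nilpotent_part A = P * (0\<^sub>m s s \<oplus>\<^sub>d N) * Q" .
qed

lemma core_part_add_nilpotent_part:
  "core_part A \<in> carrier_mat n n \<Longrightarrow> A \<in> carrier_mat n n \<Longrightarrow> core_part A + nilpotent_part A = A"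
  by (intro eq_matI) (auto simp: nilpotent_part_def)

section \<open>Rank, column space and index\<close>

text \<open>
  A basis of the subspace is an independent set of full size, hence a basis of the whole space.
\<close>

lemma (in vectorspace) subspace_eq_of_dim:
  assumes X: "VectorSpace.subspace K X V" and fin: "fin_dim" "vectorspace.fin_dim K (vs X)"
    and dim: "vectorspace.dim K (vs X) = dim"
  shows "X = carrier V"
proof -
  interpret X: vectorspace K "vs X" using X subspace_is_vs by blast
  from X.finite_basis_exists fin(2) obtain b where b: "finite b" "X.basis b" by blast
  have bX: "b \<subseteq> X" "X.span b = X" "X.lin_indpt b" using b(2) by (auto simp: X.basis_def)
  have sub: "submodule K X V" using X by (simp add: VectorSpace.subspace_def)
  have XV: "X \<subseteq> carrier V" using sub by (simp add: submodule_def)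
  have "lin_indpt b" "span b = X" using span_li_not_depend[OF bX(1) sub] bX by auto
  moreover have "card b = dim" using X.dim_basis[OF b] dim by simp
  ultimately have "basis b" using dim_li_is_basis[OF fin(1) b(1)] bX XV by auto
  then show ?thesis using \<open>span b = X\<close> by (simp add: basis_def)
qed

context vec_space
begin

lemma col_space_mult_subset:
  assumes A: "A \<in> carrier_mat n m" and B: "B \<in> carrier_mat m p"
  shows "col_space (A * B) \<subseteq> col_space A"
proof -
  have AB: "A * B \<in> carrier_mat n p" using A B by simp
  show ?thesis
  proof
    fix v assume "v \<in> col_space (A * B)"
    then obtain x where x: "x \<in> carrier_vec p" "v = A * B *\<^sub>v x" using AB B by (auto simp: col_space_eq[OF AB])
    then have "v = A *\<^sub>v (B *\<^sub>v x)" using A B by simp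
    then show "v \<in> col_space A" using A B x by (auto simp: col_space_eq[OF A])
  qed
qed

lemma col_space_subspace:
  assumes "A \<in> carrier_mat n m"
  shows "VectorSpace.subspace class_ring (col_space A) V" "vectorspace.fin_dim class_ring (vs (col_space A))"
  using assms cols_dim[of A] fin_dim_span_cols[OF assms] by (auto simp: col_space_def intro!: span_is_subspace)

lemma rank_col_space: "rank A = vectorspace.dim class_ring (vs (col_space A))"
  by (simp add: rank_def col_space_def)

lemma rank_mult_le:
  assumes A: "A \<in> carrier_mat n m" and B: "B \<in> carrier_mat m p"
  shows "rank (A * B) \<le> rank A"
proof -
  note cA = col_space_subspace[OF A] and cAB = col_space_subspace[OF mult_carrier_mat[OF A B]]
  from vectorspace.subspace_dim[OF subspace_is_vs[OF cA(1)]
      nested_subspaces[OF cA(1) cAB(1) col_space_mult_subset[OF A B]] cA(2)] cAB(2)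
  show ?thesis by (simp add: rank_col_space)
qed

text \<open>
  Equal ranks force the column spaces of \<open>A B\<close> and \<open>A\<close> to coincide, so each column of \<open>A\<close> is \<open>A B\<close>
  applied to some vector; these vectors are the columns of \<open>Y\<close>.
\<close>

lemma rank_mult_eq_factor:
  assumes A: "A \<in> carrier_mat n m" and B: "B \<in> carrier_mat m p" and eq: "rank (A * B) = rank A"
  shows "\<exists>Y \<in> carrier_mat p m. A * B * Y = A"
proof -
  have AB: "A * B \<in> carrier_mat n p" using A B by simp
  note cA = col_space_subspace[OF A] and cAB = col_space_subspace[OF AB]
  from vectorspace.subspace_eq_of_dim[OF subspace_is_vs[OF cA(1)]
      nested_subspaces[OF cA(1) cAB(1) col_space_mult_subset[OF A B]] cA(2)] cAB(2) eq
  have col: "col_space (A * B) = col_space A" by (simp add: rank_col_space)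
  have "\<exists>y \<in> carrier_vec p. A * B *\<^sub>v y = col A j" if j: "j < m" for j
  proof -
    have "col A j \<in> set (cols A)" using A j by (auto simp: cols_def)
    then have "col A j \<in> col_space A" unfolding col_space_def by (rule span_mem[rotated]) (use A cols_dim[of A] in auto)
    then show ?thesis using B unfolding col[symmetric] by (auto simp: col_space_eq[OF AB])
  qed
  then obtain y where y: "\<And>j. j < m \<Longrightarrow> y j \<in> carrier_vec p" "\<And>j. j < m \<Longrightarrow> A * B *\<^sub>v y j = col A j" by metis
  define Y where "Y = mat p m (\<lambda>(i, j). y j $ i)"
  have Y: "Y \<in> carrier_mat p m" by (simp add: Y_def)
  have "A * B * Y = A"
  proof (rule mat_col_eqI)
    fix j assume "j < dim_col A"
    then have j: "j < m" using A by simp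
    have "col Y j = y j" using y(1)[OF j] j by (intro eq_vecI) (auto simp: Y_def)
    then show "col (A * B * Y) j = col A j" using y(2)[OF j] col_mult2[OF AB Y j] by simp
  qed (use A B Y in auto)
  with Y show ?thesis by blast
qed

end

text \<open>
  The least exponent in the definition of the index exists because the ranks of the powers cannot
  decrease forever. From here on the index enters only through this factorization.
\<close>

lemma mindex_factor:
  assumes A: "A \<in> carrier_mat n n"
  shows "\<exists>Y \<in> carrier_mat n n. A ^\<^sub>m (mindex A + 1) * Y = A ^\<^sub>m mindex A"
proof -
  interpret vec_space "TYPE(complex)" n .
  have p: "A ^\<^sub>m k \<in> carrier_mat n n" for k using A by simp
  have r: "mrank (A ^\<^sub>m k) = rank (A ^\<^sub>m k)" for k
    using p[of k] unfolding mrank_def by (simp only: carrier_matD(1))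
  have le: "rank (A ^\<^sub>m (k + 1)) \<le> rank (A ^\<^sub>m k)" for k using rank_mult_le[OF p A] by simp
  have "\<exists>k. mrank (A ^\<^sub>m k) = mrank (A ^\<^sub>m (k + 1))"
  proof (rule ccontr)
    assume no: "\<not> ?thesis"
    have lt: "rank (A ^\<^sub>m (k + 1)) < rank (A ^\<^sub>m k)" for k
      using no le[of k] r by (metis le_neq_implies_less)
    have "rank (A ^\<^sub>m k) + k \<le> rank (A ^\<^sub>m 0)" for k
    proof (induction k)
      case (Suc k)
      then show ?case using lt[of k] by (simp del: pow_mat.simps)
    qed simp
    from this[of "Suc (rank (A ^\<^sub>m 0))"] show False by linarith
  qed
  from LeastI_ex[OF this] have "mrank (A ^\<^sub>m mindex A) = mrank (A ^\<^sub>m (mindex A + 1))"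
    unfolding mindex_def[symmetric] .
  then have "rank (A ^\<^sub>m mindex A * A) = rank (A ^\<^sub>m mindex A)" unfolding r by simp
  from rank_mult_eq_factor[OF p A this] show ?thesis by simp
qed

section \<open>The discrete cosine transform\<close>

text \<open>
  The cosine sampled by row \<open>j\<close> of the DCT matrix, as a function of a real position: the reflection
  identities below evaluate it outside of the sampling range.
\<close>

definition dct_wave :: "nat \<Rightarrow> nat \<Rightarrow> real \<Rightarrow> real" where
  "dct_wave n j x = cos (real j * (2 * x + 1) * pi / (2 * real n))"

text \<open>
  Multiplying by \<open>2 sin a\<close>, where \<open>a = m \<pi> / (2 n)\<close>, makes the sum telescope to \<open>sin (m \<pi>) = 0\<close>.
\<close>

lemma sum_dct_wave:
  assumes "0 < m" "m < 2 * n"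
  shows "(\<Sum>p<n. dct_wave n m (real p)) = 0"
proof -
  define a where "a = real m * pi / (2 * real n)"
  have n: "0 < n" using assms by simp
  have a: "0 < a" "a < pi" using assms n by (auto simp: a_def field_simps)
  have wave: "dct_wave n m (real p) = cos ((2 * real p + 1) * a)" for p
    by (simp add: dct_wave_def a_def field_simps)
  have "2 * sin a * (\<Sum>p<N. cos ((2 * real p + 1) * a)) = sin (2 * real N * a)" for N
  proof (induction N)
    case (Suc N)
    have "sin (2 * real (Suc N) * a) = sin ((2 * real N + 1) * a + a)"
      "sin (2 * real N * a) = sin ((2 * real N + 1) * a - a)"
      by (simp_all add: algebra_simps)
    then have "sin (2 * real (Suc N) * a) = sin (2 * real N * a) + 2 * sin a * cos ((2 * real N + 1) * a)"
      unfolding sin_add sin_diff by simp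
    with Suc.IH show ?case by (simp add: algebra_simps)
  qed simp
  from this[of n] have "2 * sin a * (\<Sum>p<n. dct_wave n m (real p)) = sin (real m * pi)"
    using n by (simp add: wave a_def)
  moreover have "sin a \<noteq> 0" using sin_gt_zero[OF a] by simp
  ultimately show ?thesis by simp
qed

text \<open>
  The product-to-sum formula reduces this to the vanishing sums for the frequencies \<open>i - j\<close> and
  \<open>i + j\<close>.
\<close>

lemma dct_wave_orthogonal:
  assumes ij: "i < n" "j < n"
  shows "(\<Sum>p<n. dct_wave n i (real p) * dct_wave n j (real p)) =
    (if i = j then if i = 0 then real n else real n / 2 else 0)"
proof -
  have main: "(\<Sum>p<n. dct_wave n i (real p) * dct_wave n j (real p)) =
    (if i = j then if i = 0 then real n else real n / 2 else 0)" if ij: "j \<le> i" "i < n" for i j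
  proof -
    have "dct_wave n i x * dct_wave n j x = (dct_wave n (i - j) x + dct_wave n (i + j) x) / 2" for x
      using ij unfolding dct_wave_def cos_times_cos
      by (simp add: of_nat_diff add_divide_distrib diff_divide_distrib algebra_simps)
    then have sum: "(\<Sum>p<n. dct_wave n i (real p) * dct_wave n j (real p)) =
        ((\<Sum>p<n. dct_wave n (i - j) (real p)) + (\<Sum>p<n. dct_wave n (i + j) (real p))) / 2"
      unfolding sum.distrib[symmetric] sum_divide_distrib by (intro sum.cong) auto
    have 0: "(\<Sum>p<n. dct_wave n 0 (real p)) = real n" by (simp add: dct_wave_def)
    consider "i = 0" | "i \<noteq> 0" "i = j" | "i \<noteq> j" by blast
    then show ?thesis
    proof cases
      case 1
      with ij sum 0 show ?thesis by simp
    next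
      case 2
      with ij sum 0 sum_dct_wave[of "i + j" n] show ?thesis by simp
    next
      case 3
      with ij sum sum_dct_wave[of "i + j" n] sum_dct_wave[of "i - j" n] show ?thesis by simp
    qed
  qed
  show ?thesis
  proof (cases "j \<le> i")
    case True
    with main ij show ?thesis by simp
  next
    case False
    with main[of i j] ij show ?thesis by (auto simp: mult.commute)
  qed
qed

lemma dct_mat_index:
  "j < n \<Longrightarrow> k < n \<Longrightarrow> dct_mat n $$ (j, k) =
     complex_of_real (sqrt ((2 - (if j = 0 then 1 else 0)) / real n) * dct_wave n j (real k))"
  by (simp add: dct_mat_def dct_wave_def)

lemma dct_mat_carrier: "dct_mat n \<in> carrier_mat n n"
  by (simp add: dct_mat_def)

lemma dct_mat_orthogonal: "dct_mat n * (dct_mat n)\<^sup>T = 1\<^sub>m n"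
proof (rule eq_matI)
  fix i j assume "i < dim_row (1\<^sub>m n :: complex mat)" "j < dim_col (1\<^sub>m n :: complex mat)"
  then have ij: "i < n" "j < n" by auto
  let ?s = "\<lambda>j. sqrt ((2 - (if j = 0 then 1 else 0)) / real n)"
  have "(dct_mat n * (dct_mat n)\<^sup>T) $$ (i, j) = (\<Sum>p<n. dct_mat n $$ (i, p) * dct_mat n $$ (j, p))"
    using ij dct_mat_carrier[of n] by (simp add: scalar_prod_def atLeast0LessThan)
  also have "\<dots> = complex_of_real (?s i * ?s j * (\<Sum>p<n. dct_wave n i (real p) * dct_wave n j (real p)))"
    using ij unfolding of_real_sum sum_distrib_left
    by (intro sum.cong) (simp_all add: dct_mat_index)
  also have "\<dots> = 1\<^sub>m n $$ (i, j)"
  proof -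
    have "?s i * ?s j * (\<Sum>p<n. dct_wave n i (real p) * dct_wave n j (real p)) = (if i = j then 1 else 0)"
      unfolding dct_wave_orthogonal[OF ij] using ij by auto
    then show ?thesis using ij by (simp only: index_one_mat) simp
  qed
  finally show "(dct_mat n * (dct_mat n)\<^sup>T) $$ (i, j) = 1\<^sub>m n $$ (i, j)" .
qed (use dct_mat_carrier[of n] in auto)

lemma dct_wave_0_pos: "k < n \<Longrightarrow> 0 < dct_wave n k 0"
  unfolding dct_wave_def
  by (intro cos_gt_zero_pi) (auto simp: field_simps intro: less_le_trans[of _ 0])

lemma dct_mat_first_column_nonzero:
  assumes "k < n"
  shows "dct_mat n $$ (k, 0) \<noteq> 0"
  using assms dct_wave_0_pos[OF assms] by (simp add: dct_mat_index)

lemma W_mat_inverse_pair: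
  "inverse_pair n (W_mat n) (mat_diag n (\<lambda>i. inverse (dct_mat n $$ (i, 0))))"
proof -
  have "mat_diag n (\<lambda>i. dct_mat n $$ (i, 0) * inverse (dct_mat n $$ (i, 0))) = 1\<^sub>m n"
    using dct_mat_first_column_nonzero by (intro eq_matI) (auto simp: mat_diag_def)
  then show ?thesis
    by (simp add: inverse_pair_def W_mat_def mult.commute)
qed

lemma Z_mat_carrier: "Z_mat n \<in> carrier_mat n n"
  by (simp add: Z_mat_def)

lemma M_mat_carrier: "M_mat n \<in> carrier_mat n n"
  unfolding M_mat_def minv_eq[OF W_mat_inverse_pair]
  by (intro mult_carrier_mat[of _ n n] dct_mat_carrier mat_diag_dim add_carrier_mat Z_mat_carrier)

lemma M_mat_invertible: "\<exists>M'. inverse_pair n (M_mat n) M'"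
proof (rule inverse_pair_of_det[OF M_mat_carrier])
  let ?W' = "mat_diag n (\<lambda>i. inverse (dct_mat n $$ (i, 0)))"
  have W': "?W' \<in> carrier_mat n n" "det ?W' \<noteq> 0"
    using det_of_inverse_pair[OF inverse_pair_sym[OF W_mat_inverse_pair]] by auto
  have "det (dct_mat n) * det (dct_mat n)\<^sup>T = 1"
    using det_mult[OF dct_mat_carrier, of "(dct_mat n)\<^sup>T" n] dct_mat_carrier[of n]
    by (simp add: dct_mat_orthogonal)
  then have C: "det (dct_mat n) \<noteq> 0" by auto
  have IZ: "1\<^sub>m n + Z_mat n \<in> carrier_mat n n" using Z_mat_carrier by simp
  have "det (1\<^sub>m n + Z_mat n) = prod_list (diag_mat (1\<^sub>m n + Z_mat n))"
    by (rule det_upper_triangular[OF _ IZ]) (auto simp: Z_mat_def)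
  also have "\<dots> = 1" using Z_mat_carrier by (auto simp: prod_list_diag_prod Z_mat_def intro!: prod.neutral)
  finally have "det (1\<^sub>m n + Z_mat n) = 1" .
  moreover have "det (M_mat n) = det ?W' * det (dct_mat n) * det (1\<^sub>m n + Z_mat n)"
    unfolding M_mat_def minv_eq[OF W_mat_inverse_pair]
    using det_mult[OF mult_carrier_mat[OF W'(1) dct_mat_carrier] IZ] det_mult[OF W'(1) dct_mat_carrier]
    by simp
  ultimately show "det (M_mat n) \<noteq> 0" using W' C by simp
qed

lemma dct_wave_add_diff:
  "dct_wave n k (x + y) + dct_wave n k (x - y) =
    2 * cos (real k * y * pi / real n) * dct_wave n k x"
proof -
  define u v where "u = real k * (2 * x + 1) * pi / (2 * real n)" and "v = real k * y * pi / real n"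
  have "real k * (2 * (x + y) + 1) * pi / (2 * real n) = u + v"
    "real k * (2 * (x - y) + 1) * pi / (2 * real n) = u - v"
    by (cases "n = 0"; simp add: u_def v_def field_simps)+
  then show ?thesis unfolding dct_wave_def by (simp add: cos_add cos_diff flip: u_def v_def)
qed

text \<open>
  For \<open>l > 0\<close>, column \<open>l\<close> of \<open>C (I + Z)\<close> adds the samples of each cosine at \<open>l\<close> and \<open>l - 1\<close>. By reflection the latter
  equals the value at \<open>- l\<close>, so the sum is \<open>2 cos (k l \<pi> / n)\<close> times the sample at 0, which is the factor
  that \<open>W\<close> divides out.
\<close>

lemma M_mat_index:
  assumes "k < n" "l < n"
  shows "M_mat n $$ (k, l) =
    complex_of_real (if l = 0 then 1 else 2 * cos (real k * real l * pi / real n))"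
proof -
  let ?C = "dct_mat n"
  define B where "B = mat n n (\<lambda>(i, j). inverse (?C $$ (i, 0)) * ?C $$ (i, j))"
  have B: "minv (W_mat n) * ?C = B"
    unfolding minv_eq[OF W_mat_inverse_pair] B_def by (rule mat_diag_mult_left[OF dct_mat_carrier])
  have "M_mat n $$ (k, l) = (\<Sum>m<n. B $$ (k, m) * (1\<^sub>m n + Z_mat n) $$ (m, l))"
    unfolding M_mat_def B using assms Z_mat_carrier[of n]
    by (simp add: B_def scalar_prod_def atLeast0LessThan)
  also have "\<dots> = (\<Sum>m<n. (if m = l then B $$ (k, m) else 0) + (if Suc m = l then B $$ (k, m) else 0))"
    using assms by (intro sum.cong) (auto simp: Z_mat_def)
  also have "\<dots> = B $$ (k, l) + (if l = 0 then 0 else B $$ (k, l - 1))"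
    using assms by (cases l) (auto simp: sum.distrib)
  also have "\<dots> = complex_of_real (if l = 0 then 1 else 2 * cos (real k * real l * pi / real n))"
  proof -
    have c0: "?C $$ (k, 0) \<noteq> 0" using dct_mat_first_column_nonzero[OF assms(1)] .
    have "?C $$ (k, l) + ?C $$ (k, l - 1) = ?C $$ (k, 0) * complex_of_real (2 * cos (real k * real l * pi / real n))"
      if "l \<noteq> 0"
    proof -
      define w where "w = sqrt ((2 - (if k = 0 then 1 else 0)) / real n)"
      have "dct_wave n k (- real l) = dct_wave n k (real l - 1)"
      proof -
        have "real k * (2 * - real l + 1) * pi / (2 * real n) = - (real k * (2 * (real l - 1) + 1) * pi / (2 * real n))"
          by (simp add: algebra_simps diff_divide_distrib add_divide_distrib)
        then show ?thesis unfolding dct_wave_def by (simp only: cos_minus)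
      qed
      then have "dct_wave n k (real l) + dct_wave n k (real l - 1) =
          2 * cos (real k * real l * pi / real n) * dct_wave n k 0"
        using dct_wave_add_diff[of n k 0 "real l"] by simp
      then have "w * dct_wave n k (real l) + w * dct_wave n k (real l - 1) =
          w * dct_wave n k 0 * (2 * cos (real k * real l * pi / real n))"
        by (simp only: distrib_left[symmetric] mult.assoc mult.commute mult.left_commute)
      from arg_cong[OF this, of complex_of_real] show ?thesis using assms that
        by (simp add: dct_mat_index of_nat_diff w_def)
    qed
    then show ?thesis using assms c0 by (auto simp: B_def field_simps)
  qed
  finally show ?thesis .
qed

section \<open>Tensors under the C-product\<close>

lemma tensor_carrier_slice: "A \<in> tensor_carrier n1 n2 n3 \<Longrightarrow> i < n3 \<Longrightarrow> A ! i \<in> carrier_mat n1 n2"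
  by (auto simp: tensor_carrier_def)

lemma tensor_carrier_dims:
  assumes "A \<in> tensor_carrier n1 n2 n3"
  shows "length A = n3" "n3 \<noteq> 0 \<Longrightarrow> trows A = n1" "n3 \<noteq> 0 \<Longrightarrow> tcols A = n2"
  using assms by (cases A; auto simp: tensor_carrier_def trows_def tcols_def)+

lemma tensor_carrierI:
  "length A = n3 \<Longrightarrow> (\<And>i. i < n3 \<Longrightarrow> A ! i \<in> carrier_mat n1 n2) \<Longrightarrow> A \<in> tensor_carrier n1 n2 n3"
  by (auto simp: tensor_carrier_def in_set_conv_nth)

lemma tensor_carrier_0: "tensor_carrier n1 n2 0 = {[]}"
  by (auto simp: tensor_carrier_def)

lemma tensor_eqI:
  assumes "A \<in> tensor_carrier n1 n2 n3" "B \<in> tensor_carrier n1 n2 n3" "\<And>i. i < n3 \<Longrightarrow> A ! i = B ! i"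
  shows "A = B"
  using assms by (auto simp: tensor_carrier_def intro: nth_equalityI)

lemma L_trans_index:
  assumes A: "A \<in> tensor_carrier n1 n2 n3" and "k < n3"
  shows "L_trans A ! k = mat n1 n2 (\<lambda>(i, j). \<Sum>l<n3. M_mat n3 $$ (k, l) * (A ! l) $$ (i, j))"
  using tensor_carrier_dims[OF A] assms by (simp add: L_trans_def)

lemma L_trans_slice_carrier:
  "A \<in> tensor_carrier n1 n2 n3 \<Longrightarrow> k < n3 \<Longrightarrow> L_trans A ! k \<in> carrier_mat n1 n2"
  by (simp add: L_trans_index)

lemma inverse_pair_sum:
  assumes "inverse_pair n A B" "k < n"
  shows "(\<Sum>l<n. A $$ (k, l) * (\<Sum>m<n. B $$ (l, m) * f m)) = f k"
proof -
  note AB = inverse_pairD[OF assms(1)]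
  have "(\<Sum>l<n. A $$ (k, l) * (\<Sum>m<n. B $$ (l, m) * f m)) = (\<Sum>m<n. (\<Sum>l<n. A $$ (k, l) * B $$ (l, m)) * f m)"
    unfolding sum_distrib_left sum_distrib_right by (subst sum.swap) (simp add: mult.assoc)
  also have "\<dots> = (\<Sum>m<n. (A * B) $$ (k, m) * f m)"
    using AB(1,2) assms(2) by (intro sum.cong) (auto simp: scalar_prod_def atLeast0LessThan)
  also have "\<dots> = (\<Sum>m<n. if m = k then f m else 0)"
    unfolding AB(3) using assms(2) by (intro sum.cong) auto
  also have "\<dots> = f k" using assms(2) by simp
  finally show ?thesis .
qed

lemma L_trans_inject:
  assumes A: "A \<in> tensor_carrier n1 n2 n3" and B: "B \<in> tensor_carrier n1 n2 n3"
    and eq: "\<And>i. i < n3 \<Longrightarrow> L_trans A ! i = L_trans B ! i"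
  shows "A = B"
proof (rule tensor_eqI[OF A B])
  fix k assume k: "k < n3"
  obtain M' where M': "inverse_pair n3 (M_mat n3) M'" using M_mat_invertible by blast
  show "A ! k = B ! k"
  proof (rule eq_matI)
    fix i j assume "i < dim_row (B ! k)" "j < dim_col (B ! k)"
    then have ij: "i < n1" "j < n2" using tensor_carrier_slice[OF B k] by auto
    have L: "(L_trans T ! l) $$ (i, j) = (\<Sum>m<n3. M_mat n3 $$ (l, m) * (T ! m) $$ (i, j))"
      if "T \<in> tensor_carrier n1 n2 n3" "l < n3" for T l
      using ij by (simp add: L_trans_index[OF that])
    have rec: "(T ! k) $$ (i, j) = (\<Sum>l<n3. M' $$ (k, l) * (L_trans T ! l) $$ (i, j))"
      if "T \<in> tensor_carrier n1 n2 n3" for T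
      using inverse_pair_sum[OF inverse_pair_sym[OF M'] k, of "\<lambda>m. (T ! m) $$ (i, j)"] by (simp add: L[OF that])
    show "(A ! k) $$ (i, j) = (B ! k) $$ (i, j)"
      unfolding rec[OF A] rec[OF B] by (simp add: eq)
  qed (use tensor_carrier_slice[OF A k] tensor_carrier_slice[OF B k] in auto)
qed

text \<open>
  A tensor with prescribed slices under \<open>L\<close> is obtained by applying the inverse of \<open>M\<close> along the third
  mode.
\<close>

lemma L_trans_surject:
  assumes S: "\<And>i. i < n3 \<Longrightarrow> S i \<in> carrier_mat n1 n2"
  shows "\<exists>A \<in> tensor_carrier n1 n2 n3. \<forall>i<n3. L_trans A ! i = S i"
proof -
  obtain M' where M': "inverse_pair n3 (M_mat n3) M'" using M_mat_invertible by blast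
  define A where "A = map (\<lambda>k. mat n1 n2 (\<lambda>(i, j). \<Sum>l<n3. M' $$ (k, l) * S l $$ (i, j))) [0..<n3]"
  have A: "A \<in> tensor_carrier n1 n2 n3" by (rule tensor_carrierI) (auto simp: A_def)
  have "L_trans A ! k = S k" if k: "k < n3" for k
  proof (rule eq_matI)
    fix i j assume "i < dim_row (S k)" "j < dim_col (S k)"
    then have ij: "i < n1" "j < n2" using S[OF k] by auto
    show "(L_trans A ! k) $$ (i, j) = S k $$ (i, j)"
      unfolding L_trans_index[OF A k]
      using ij inverse_pair_sum[OF M' k, of "\<lambda>m. S m $$ (i, j)"] by (simp add: A_def)
  qed (use S[OF k] L_trans_slice_carrier[OF A k] in auto)
  with A show ?thesis by blast
qed

lemma tensor_from_L:
  assumes S: "\<And>i. i < n3 \<Longrightarrow> S i \<in> carrier_mat n1 n2"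
  shows "tensor_from_L n1 n2 n3 S \<in> tensor_carrier n1 n2 n3"
    and "i < n3 \<Longrightarrow> L_trans (tensor_from_L n1 n2 n3 S) ! i = S i"
proof -
  obtain A where A: "A \<in> tensor_carrier n1 n2 n3" "\<forall>i<n3. L_trans A ! i = S i"
    using L_trans_surject[of n3 S n1 n2, OF S] by blast
  have "\<exists>!X. X \<in> tensor_carrier n1 n2 n3 \<and> (\<forall>i<n3. L_trans X ! i = S i)"
    using A L_trans_inject[of _ n1 n2 n3] by (intro ex1I[of _ A]) auto
  from theI'[OF this] show "tensor_from_L n1 n2 n3 S \<in> tensor_carrier n1 n2 n3"
    "i < n3 \<Longrightarrow> L_trans (tensor_from_L n1 n2 n3 S) ! i = S i"
    by (auto simp: tensor_from_L_def)
qed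

lemma cprod_L:
  assumes A: "A \<in> tensor_carrier n1 n2 n3" and B: "B \<in> tensor_carrier n2 l n3"
  shows cprod_carrier: "A *\<^sub>c B \<in> tensor_carrier n1 l n3"
    and L_trans_cprod: "i < n3 \<Longrightarrow> L_trans (A *\<^sub>c B) ! i = L_trans A ! i * L_trans B ! i"
proof -
  have c: "L_trans A ! i * L_trans B ! i \<in> carrier_mat n1 l" if "i < n3" for i
    using L_trans_slice_carrier[OF A that] L_trans_slice_carrier[OF B that] by auto
  have e: "A *\<^sub>c B = tensor_from_L (trows A) (tcols B) n3 (\<lambda>i. L_trans A ! i * L_trans B ! i)"
    by (simp add: cprod_def tensor_carrier_dims(1)[OF A])
  have "A *\<^sub>c B \<in> tensor_carrier n1 l n3 \<and>
      (i < n3 \<longrightarrow> L_trans (A *\<^sub>c B) ! i = L_trans A ! i * L_trans B ! i)"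
  proof (cases "n3 = 0")
    case True
    then show ?thesis
      using tensor_from_L(1)[of 0 "\<lambda>i. L_trans A ! i * L_trans B ! i" "trows A" "tcols B"]
      unfolding e by (auto simp: tensor_carrier_0)
  next
    case False
    then show ?thesis
      using tensor_carrier_dims[OF A] tensor_carrier_dims[OF B]
        tensor_from_L[of n3 "\<lambda>i. L_trans A ! i * L_trans B ! i" n1 l, OF c]
      unfolding e by auto
  qed
  then show "A *\<^sub>c B \<in> tensor_carrier n1 l n3"
    "i < n3 \<Longrightarrow> L_trans (A *\<^sub>c B) ! i = L_trans A ! i * L_trans B ! i" by auto
qed

lemma tid_L:
  shows tid_carrier: "tid n n3 \<in> tensor_carrier n n n3"
    and L_trans_tid: "i < n3 \<Longrightarrow> L_trans (tid n n3) ! i = 1\<^sub>m n"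
  unfolding tid_def by (rule tensor_from_L; simp)+

lemma tid_trows:
  assumes "A \<in> tensor_carrier n n' n3"
  shows "tid (trows A) (length A) = tid n n3"
proof (cases "n3 = 0")
  case True
  then show ?thesis
    using tid_carrier[of "trows A" 0] tid_carrier[of n 0] tensor_carrier_dims(1)[OF assms]
    by (auto simp: tensor_carrier_0)
qed (use tensor_carrier_dims[OF assms] in auto)

text \<open>
  For the empty tensor the number of rows is unspecified, but all tensors without slices are equal.
  Facts of this kind let the case of no slices be treated together with the others.
\<close>

lemma tensor_carrier_trows:
  assumes "A \<in> tensor_carrier n n' n3"
  shows "tensor_carrier (trows A) (trows A) (length A) = tensor_carrier n n n3"
  using tensor_carrier_dims[OF assms] by (cases "n3 = 0") (auto simp: tensor_carrier_0)

lemma tpow_L: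
  assumes A: "A \<in> tensor_carrier n n n3"
  shows tpow_carrier: "tpow A k \<in> tensor_carrier n n n3"
    and L_trans_tpow: "i < n3 \<Longrightarrow> L_trans (tpow A k) ! i = (L_trans A ! i) ^\<^sub>m k"
proof -
  have "tpow A k \<in> tensor_carrier n n n3 \<and> (i < n3 \<longrightarrow> L_trans (tpow A k) ! i = (L_trans A ! i) ^\<^sub>m k)"
  proof (induction k)
    case 0
    then show ?case
      using L_trans_slice_carrier[OF A, of i] by (auto simp: tid_trows[OF A] tid_carrier L_trans_tid)
  next
    case (Suc k)
    then show ?case by (auto intro: cprod_carrier A simp: L_trans_cprod[OF _ A])
  qed
  then show "tpow A k \<in> tensor_carrier n n n3"
    "i < n3 \<Longrightarrow> L_trans (tpow A k) ! i = (L_trans A ! i) ^\<^sub>m k" by auto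
qed

lemma tensor_eq_iff_L:
  assumes "A \<in> tensor_carrier n1 n2 n3" "B \<in> tensor_carrier n1 n2 n3"
  shows "A = B \<longleftrightarrow> (\<forall>i<n3. L_trans A ! i = L_trans B ! i)"
  using L_trans_inject[OF assms] by auto

lemma is_tinverse_iff:
  assumes B: "B \<in> tensor_carrier n n n3"
  shows "is_tinverse B X \<longleftrightarrow>
    X \<in> tensor_carrier n n n3 \<and> (\<forall>i<n3. inverse_pair n (L_trans B ! i) (L_trans X ! i))"
proof (cases "X \<in> tensor_carrier n n n3")
  case X: True
  show ?thesis
    unfolding is_tinverse_def tid_trows[OF B] tensor_carrier_trows[OF B]
      tensor_eq_iff_L[OF cprod_carrier[OF B X] tid_carrier]
      tensor_eq_iff_L[OF cprod_carrier[OF X B] tid_carrier]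
    using X L_trans_slice_carrier[OF X] L_trans_slice_carrier[OF B]
    by (auto simp: L_trans_cprod[OF B X] L_trans_cprod[OF X B] L_trans_tid inverse_pair_def)
qed (simp add: is_tinverse_def tensor_carrier_trows[OF B])

lemma inverse_pair_unique: "inverse_pair n A B \<Longrightarrow> inverse_pair n A C \<Longrightarrow> B = C"
  using minv_eq by blast

lemma tinverse_L:
  assumes B: "B \<in> tensor_carrier n n n3"
    and inv: "\<And>i. i < n3 \<Longrightarrow> inverse_pair n (L_trans B ! i) (S i)"
  shows "tinvertible B" "tinv B \<in> tensor_carrier n n n3"
    "i < n3 \<Longrightarrow> L_trans (tinv B) ! i = S i"
proof -
  have S: "S i \<in> carrier_mat n n" if "i < n3" for i using inverse_pairD[OF inv[OF that]] by simp
  define X where "X = tensor_from_L n n n3 S"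
  have X: "X \<in> tensor_carrier n n n3" unfolding X_def by (rule tensor_from_L(1)[OF S])
  have LX: "L_trans X ! i = S i" if "i < n3" for i unfolding X_def by (rule tensor_from_L(2)[OF S that])
  have isX: "is_tinverse B X" using inv X LX by (simp add: is_tinverse_iff[OF B])
  then show "tinvertible B" by (auto simp: tinvertible_def)
  have "tinv B = X"
    unfolding tinv_def
  proof (rule the_equality)
    show "is_tinverse B X" by (rule isX)
  next
    fix Y assume "is_tinverse B Y"
    then have Y: "Y \<in> tensor_carrier n n n3" "\<And>i. i < n3 \<Longrightarrow> inverse_pair n (L_trans B ! i) (L_trans Y ! i)"
      by (auto simp: is_tinverse_iff[OF B])
    show "Y = X" by (rule L_trans_inject[OF Y(1) X]) (use Y(2) inv LX inverse_pair_unique in metis)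
  qed
  then show "tinv B \<in> tensor_carrier n n n3" "i < n3 \<Longrightarrow> L_trans (tinv B) ! i = S i"
    using X LX by auto
qed

text \<open>
  Slicewise the defining equations are those of \<open>is_drazin\<close> with the index of the tensor as
  exponent, so uniqueness on each slice makes the tensor unique.
\<close>

lemma tdrazin_eqI:
  assumes A: "A \<in> tensor_carrier n n n3" and X: "X \<in> tensor_carrier n n n3"
    and d: "\<And>i. i < n3 \<Longrightarrow> is_drazin (tindex A) (L_trans A ! i) (L_trans X ! i)"
  shows "tdrazin A = X"
proof -
  have iff: "(tpow A (tindex A + 1) *\<^sub>c Y = tpow A (tindex A) \<and> Y *\<^sub>c A *\<^sub>c Y = Y \<and> A *\<^sub>c Y = Y *\<^sub>c A) \<longleftrightarrow>
      (\<forall>i<n3. is_drazin (tindex A) (L_trans A ! i) (L_trans Y ! i))"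
    if Y: "Y \<in> tensor_carrier n n n3" for Y
  proof -
    note c = cprod_carrier[OF tpow_carrier[OF A] Y] tpow_carrier[OF A]
      cprod_carrier[OF cprod_carrier[OF Y A] Y] cprod_carrier[OF A Y] cprod_carrier[OF Y A]
    show ?thesis
      unfolding tensor_eq_iff_L[OF c(1,2)] tensor_eq_iff_L[OF c(3) Y] tensor_eq_iff_L[OF c(4,5)]
      by (auto simp: L_trans_cprod[OF tpow_carrier[OF A] Y] L_trans_cprod[OF cprod_carrier[OF Y A] Y]
          L_trans_cprod[OF Y A] L_trans_cprod[OF A Y] L_trans_tpow[OF A] is_drazin_def
          simp del: tpow.simps pow_mat.simps)
  qed
  show ?thesis
    unfolding tdrazin_def tensor_carrier_trows[OF A]
  proof (rule the_equality)
    show "X \<in> tensor_carrier n n n3 \<and> tpow A (tindex A + 1) *\<^sub>c X = tpow A (tindex A) \<and>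
        X *\<^sub>c A *\<^sub>c X = X \<and> A *\<^sub>c X = X *\<^sub>c A"
      using iff[OF X] X d by blast
  next
    fix Y assume "Y \<in> tensor_carrier n n n3 \<and> tpow A (tindex A + 1) *\<^sub>c Y = tpow A (tindex A) \<and>
        Y *\<^sub>c A *\<^sub>c Y = Y \<and> A *\<^sub>c Y = Y *\<^sub>c A"
    then have Y: "Y \<in> tensor_carrier n n n3"
      "\<And>i. i < n3 \<Longrightarrow> is_drazin (tindex A) (L_trans A ! i) (L_trans Y ! i)"
      using iff by blast+
    show "Y = X"
      by (rule L_trans_inject[OF Y(1) X], rule is_drazin_unique[OF _ _ _ Y(2) d])
        (auto intro: L_trans_slice_carrier[OF A] L_trans_slice_carrier[OF X] L_trans_slice_carrier[OF Y(1)])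
  qed
qed

lemma tzero_carrier: "tzero n1 n2 n3 \<in> tensor_carrier n1 n2 n3"
  by (rule tensor_carrierI) (auto simp: tzero_def)

lemma tblock_diag_carrier:
  assumes C: "C \<in> tensor_carrier r r n3" and N: "N \<in> tensor_carrier m m n3"
  shows "tblock C (tzero r m n3) (tzero m r n3) N \<in> tensor_carrier (r + m) (r + m) n3"
  using tensor_carrier_dims(1)[OF C]
  by (intro tensor_carrierI)
    (auto simp: tblock_def intro!: four_block_carrier_mat tensor_carrier_slice[OF C] tensor_carrier_slice[OF N])

lemma L_trans_tblock_diag:
  assumes C: "C \<in> tensor_carrier r r n3" and N: "N \<in> tensor_carrier m m n3" and k: "k < n3"
  shows "L_trans (tblock C (tzero r m n3) (tzero m r n3) N) ! k = L_trans C ! k \<oplus>\<^sub>d L_trans N ! k"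
proof -
  have c: "dim_row (C ! l) = r" "dim_col (C ! l) = r" "dim_row (N ! l) = m" "dim_col (N ! l) = m"
    if "l < n3" for l
    using tensor_carrier_slice[OF C that] tensor_carrier_slice[OF N that] by auto
  show ?thesis
    unfolding L_trans_index[OF tblock_diag_carrier[OF C N] k] L_trans_index[OF C k] L_trans_index[OF N k]
    using tensor_carrier_dims(1)[OF C] c
    by (intro eq_matI) (auto simp: tblock_def tzero_def)
qed

lemma L_trans_tzero: "i < n3 \<Longrightarrow> L_trans (tzero n1 n2 n3) ! i = 0\<^sub>m n1 n2"
  by (rule eq_matI) (auto simp: L_trans_index[OF tzero_carrier], auto simp: tzero_def)

section \<open>The index of a tensor and of its slices\<close>

lemma sum_block_index:
  fixes f :: "nat \<Rightarrow> nat \<Rightarrow> 'a::comm_monoid_add"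
  shows "(\<Sum>x<n * N. f (x div n) (x mod n)) = (\<Sum>p<N. \<Sum>i<n. f p i)"
proof -
  have inner: "(\<Sum>x\<in>{p * n..<p * n + n}. f (x div n) (x mod n)) = (\<Sum>i<n. f p i)" for p
  proof (rule sum.reindex_bij_witness[of _ "\<lambda>i. i + p * n" "\<lambda>x. x - p * n"])
    fix x assume "x \<in> {p * n..<p * n + n}"
    moreover from this have "x div n = p" by (intro div_nat_eqI) (auto simp: mult.commute)
    ultimately show "f p (x - p * n) = f (x div n) (x mod n)"
      using minus_div_mult_eq_mod[of x n] by simp
  qed auto
  have "(\<Sum>x<n * N. f (x div n) (x mod n)) = (\<Sum>p<N. \<Sum>x\<in>{p * n..<p * n + n}. f (x div n) (x mod n))"
    by (simp add: sum.nat_group mult.commute)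
  then show ?thesis by (simp only: inner)
qed

text \<open>
  The cosines are even about \<open>-1/2\<close> and about \<open>n - 1/2\<close>, half a step beyond the
  first and the last sampling position.
\<close>

lemma dct_wave_reflect:
  shows "dct_wave n k (- 1 - x) = dct_wave n k x"
    and "0 < n \<Longrightarrow> dct_wave n k (2 * real n - 1 - x) = dct_wave n k x"
proof -
  have "real k * (2 * (- 1 - x) + 1) * pi / (2 * real n) = - (real k * (2 * x + 1) * pi / (2 * real n))"
    by (simp add: algebra_simps add_divide_distrib diff_divide_distrib)
  then show "dct_wave n k (- 1 - x) = dct_wave n k x"
    unfolding dct_wave_def by (simp only: cos_minus)
  assume "0 < n"
  then have "real k * (2 * (2 * real n - 1 - x) + 1) * pi / (2 * real n) =
      2 * real k * pi - real k * (2 * x + 1) * pi / (2 * real n)"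
    by (simp add: field_simps)
  moreover have "cos (2 * real k * pi - y) = cos y" for y
    using cos_int_2pin[of "int k"] sin_int_2pin[of "int k"] unfolding cos_diff by (simp add: algebra_simps)
  ultimately show "dct_wave n k (2 * real n - 1 - x) = dct_wave n k x"
    unfolding dct_wave_def by simp
qed

text \<open>
  The coefficient with which slice \<open>l\<close> enters block \<open>(p, q)\<close> of the Toeplitz-plus-Hankel matrix. The
  first two summands are the Toeplitz part, with the diagonal \<open>l = 0\<close> counted once; the other two are
  the upper left and lower right triangle of the Hankel part.
\<close>

definition th_coeff :: "nat \<Rightarrow> nat \<Rightarrow> nat \<Rightarrow> nat \<Rightarrow> complex" where
  "th_coeff n l p q = (if p = q + l then 1 else 0) + (if q = p + l \<and> l \<noteq> 0 then 1 else 0) +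
     (if p + q + 1 = l then 1 else 0) + (if p + q + l + 1 = 2 * n then 1 else 0)"

lemma tmat_block_entry:
  assumes A: "A \<in> tensor_carrier n n n3" and pq: "p < n3" "q < n3" and ij: "i < n" "j < n"
  shows "tmat_block A p q $$ (i, j) = (\<Sum>l<n3. (A ! l) $$ (i, j) * th_coeff n3 l p q)"
proof -
  have len: "length A = n3" "trows A = n" "tcols A = n"
    using A pq by (cases A; auto simp: tensor_carrier_def trows_def tcols_def)+
  have dim: "A ! l \<in> carrier_mat n n" if "l < n3" for l using A that by (auto simp: tensor_carrier_def)
  let ?a = "\<lambda>l. (A ! l) $$ (i, j)"
  let ?h = "if p + q + 2 \<le> n3 then ?a (p + q + 1) else if p + q + 2 = n3 + 1 then 0 else ?a (2 * n3 - 1 - p - q)"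
  have "tmat_block A p q $$ (i, j) = ?a (nat \<bar>int p - int q\<bar>) + ?h"
  proof -
    have 1: "A ! nat \<bar>int p - int q\<bar> \<in> carrier_mat n n" using pq by (intro dim) auto
    have 2: "A ! (p + q + 1) \<in> carrier_mat n n" if "p + q + 2 \<le> n3" using that by (intro dim) auto
    have 3: "A ! (2 * n3 - 1 - p - q) \<in> carrier_mat n n" if "\<not> p + q + 2 \<le> n3" "p + q + 2 \<noteq> n3 + 1"
      using that pq by (intro dim) linarith
    have e: "2 * n3 + 2 - (p + 1) - (q + 1) - 1 = 2 * n3 - 1 - p - q" "p + 1 + (q + 1) - 1 = p + q + 1"
      "p + 1 + (q + 1) = p + q + 2" by auto
    show ?thesis unfolding tmat_block_def Let_def len e using 1 2 3 ij by auto
  qed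
  also have "?a (nat \<bar>int p - int q\<bar>) = (\<Sum>l<n3. ?a l * ((if p = q + l then 1 else 0) + (if q = p + l \<and> l \<noteq> 0 then 1 else 0)))"
  proof -
    have "(\<Sum>l<n3. ?a l * ((if p = q + l then 1 else 0) + (if q = p + l \<and> l \<noteq> 0 then 1 else 0))) =
        (\<Sum>l<n3. if l = nat \<bar>int p - int q\<bar> then ?a l else 0)"
      by (intro sum.cong) auto
    then show ?thesis using pq by auto
  qed
  also have "?h = (\<Sum>l<n3. ?a l * ((if p + q + 1 = l then 1 else 0) + (if p + q + l + 1 = 2 * n3 then 1 else 0)))"
  proof -
    let ?d = "if p + q + 2 \<le> n3 then p + q + 1 else 2 * n3 - 1 - p - q"
    have "(\<Sum>l<n3. ?a l * ((if p + q + 1 = l then 1 else 0) + (if p + q + l + 1 = 2 * n3 then 1 else 0))) =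
        (\<Sum>l<n3. if l = ?d then ?a l else 0)"
      using pq by (intro sum.cong) auto
    then show ?thesis using pq by auto
  qed
  finally show ?thesis
    by (simp only: th_coeff_def sum.distrib[symmetric] distrib_left add.assoc)
qed

text \<open>
  Slice \<open>l\<close> links position \<open>q\<close> to \<open>q + l\<close> and \<open>q - l\<close>; whenever one of these leaves the range
  \<open>0, \<dots>, n - 1\<close>, the Hankel part supplies its mirror image, where the cosine has the same value. Hence
  for \<open>l > 0\<close> the sum is the cosine at \<open>q + l\<close> plus that at \<open>q - l\<close>, which is \<open>2 cos (k l \<pi> / n)\<close> times
  the cosine at \<open>q\<close>, while for \<open>l = 0\<close> both positions are \<open>q\<close> and only one is counted.
\<close>

lemma sum_dct_wave_th_coeff:
  assumes "k < n" "l < n" "q < n"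
  shows "(\<Sum>p<n. complex_of_real (dct_wave n k (real p)) * th_coeff n l p q) =
    M_mat n $$ (k, l) * complex_of_real (dct_wave n k (real q))"
proof -
  let ?c = "\<lambda>x. complex_of_real (dct_wave n k x)"
  have s1: "(\<Sum>p<n. ?c (real p) * (if p = q + l then 1 else 0)) = (if q + l < n then ?c (real q + real l) else 0)"
    by (simp add: if_distrib[of "(*) _"] cong: if_cong)
  have s2: "(\<Sum>p<n. ?c (real p) * (if q = p + l \<and> l \<noteq> 0 then 1 else 0)) = (if l \<le> q \<and> l \<noteq> 0 then ?c (real q - real l) else 0)"
  proof -
    have "(\<Sum>p<n. ?c (real p) * (if q = p + l \<and> l \<noteq> 0 then 1 else 0)) =
        (\<Sum>p<n. if p = q - l then (if l \<le> q \<and> l \<noteq> 0 then ?c (real q - real l) else 0) else 0)"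
      by (intro sum.cong) (auto simp: of_nat_diff)
    moreover have "q - l < n" using assms by linarith
    ultimately show ?thesis by simp
  qed
  have s3: "(\<Sum>p<n. ?c (real p) * (if p + q + 1 = l then 1 else 0)) = (if q < l then ?c (real q - real l) else 0)"
  proof -
    have "?c (real l - real q - 1) = ?c (real q - real l)"
      using dct_wave_reflect(1)[of n k "real q - real l"] by (simp add: algebra_simps)
    then have "(\<Sum>p<n. ?c (real p) * (if p + q + 1 = l then 1 else 0)) =
        (\<Sum>p<n. if p = l - q - 1 then (if q < l then ?c (real q - real l) else 0) else 0)"
      by (intro sum.cong) (auto simp: of_nat_diff algebra_simps)
    moreover have "l - q - 1 < n" using assms by linarith
    ultimately show ?thesis by simp
  qed
  have s4: "(\<Sum>p<n. ?c (real p) * (if p + q + l + 1 = 2 * n then 1 else 0)) = (if n \<le> q + l then ?c (real q + real l) else 0)"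
  proof -
    have e: "?c (real p) = ?c (real q + real l)" if "p + q + l + 1 = 2 * n" for p
    proof -
      have "real p = 2 * real n - 1 - (real q + real l)" using that by linarith
      then show ?thesis using dct_wave_reflect(2)[of n k "real q + real l"] assms by (simp only:)
    qed
    have "(\<Sum>p<n. ?c (real p) * (if p + q + l + 1 = 2 * n then 1 else 0)) =
        (\<Sum>p<n. if p = 2 * n - 1 - q - l then (if n \<le> q + l then ?c (real q + real l) else 0) else 0)"
    proof (rule sum.cong[OF refl])
      fix p assume p: "p \<in> {..<n}"
      show "?c (real p) * (if p + q + l + 1 = 2 * n then 1 else 0) =
          (if p = 2 * n - 1 - q - l then (if n \<le> q + l then ?c (real q + real l) else 0) else 0)"
      proof (cases "p + q + l + 1 = 2 * n")
        case True
        then have "p = 2 * n - 1 - q - l" "n \<le> q + l" using p by auto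
        then show ?thesis using e[OF True] True by (simp only: if_True mult_1_right simp_thms)
      next
        case False
        then have "\<not> (p = 2 * n - 1 - q - l \<and> n \<le> q + l)" using p assms by auto
        with False show ?thesis by (simp only: if_False mult_zero_right) auto
      qed
    qed
    then show ?thesis using assms by auto
  qed
  have "(\<Sum>p<n. ?c (real p) * th_coeff n l p q) =
      ?c (real q + real l) + (if l \<noteq> 0 then ?c (real q - real l) else 0)"
    unfolding th_coeff_def distrib_left sum.distrib s1 s2 s3 s4 by auto
  also have "\<dots> = M_mat n $$ (k, l) * ?c (real q)"
  proof (cases "l = 0")
    case False
    have "?c (real q + real l) + ?c (real q - real l) =
        complex_of_real (2 * cos (real k * real l * pi / real n) * dct_wave n k (real q))"
      unfolding dct_wave_add_diff[symmetric] by simp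
    then show ?thesis using False assms by (simp add: M_mat_index)
  qed (use assms in \<open>simp add: M_mat_index\<close>)
  finally show ?thesis .
qed

lemma tmat_carrier: "A \<in> tensor_carrier n n n3 \<Longrightarrow> 0 < n3 \<Longrightarrow> tmat A \<in> carrier_mat (n * n3) (n * n3)"
  using tensor_carrier_dims[of A n n n3] by (simp add: tmat_def)

text \<open>
  The Kronecker product of the row vector of samples of the \<open>k\<close>-th cosine with the identity matrix
  of size \<open>n\<close>.
\<close>

definition block_wave :: "nat \<Rightarrow> nat \<Rightarrow> nat \<Rightarrow> complex mat" where
  "block_wave n n3 k = mat n (n * n3) (\<lambda>(i, x).
     complex_of_real (dct_wave n3 k (real (x div n))) * (if x mod n = i then 1 else 0))"

lemma block_wave_carrier: "block_wave n n3 k \<in> carrier_mat n (n * n3)"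
  by (simp add: block_wave_def)

text \<open>
  A left eigenvector equation with matrix-valued eigenvalue. Each entry is a linear combination, over
  the slices of \<open>A\<close>, of instances of \<open>sum_dct_wave_th_coeff\<close>.
\<close>

lemma block_wave_tmat:
  assumes A: "A \<in> tensor_carrier n n n3" and k: "k < n3"
  shows "block_wave n n3 k * tmat A = L_trans A ! k * block_wave n n3 k"
proof (rule eq_matI)
  let ?c = "\<lambda>x. complex_of_real (dct_wave n3 k x)"
  have T: "tmat A \<in> carrier_mat (n * n3) (n * n3)" using tmat_carrier[OF A] k by simp
  have D: "L_trans A ! k \<in> carrier_mat n n" by (rule L_trans_slice_carrier[OF A k])
  have dims: "length A = n3" "trows A = n" "tcols A = n" using tensor_carrier_dims[OF A] k by auto
  fix i y assume "i < dim_row (L_trans A ! k * block_wave n n3 k)"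
    "y < dim_col (L_trans A ! k * block_wave n n3 k)"
  then have i: "i < n" and y: "y < n * n3" using D by (auto simp: block_wave_def)
  define q j where "q = y div n" and "j = y mod n"
  have q: "q < n3" and j: "j < n"
    using y i by (auto simp: q_def j_def less_mult_imp_div_less mult.commute)
  have "(block_wave n n3 k * tmat A) $$ (i, y) =
      (\<Sum>x<n * n3. block_wave n n3 k $$ (i, x) * tmat A $$ (x, y))"
    using i y T by (simp add: block_wave_def scalar_prod_def atLeast0LessThan)
  also have "\<dots> = (\<Sum>x<n * n3. (\<lambda>p i'. ?c (real p) * (if i' = i then 1 else 0) * tmat_block A p q $$ (i', j))
      (x div n) (x mod n))"
    using i y by (intro sum.cong) (auto simp: block_wave_def tmat_def dims q_def j_def)
  also have "\<dots> = (\<Sum>p<n3. \<Sum>i'<n. ?c (real p) * (if i' = i then 1 else 0) * tmat_block A p q $$ (i', j))"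
    by (rule sum_block_index)
  also have "\<dots> = (\<Sum>p<n3. ?c (real p) * tmat_block A p q $$ (i, j))"
  proof (rule sum.cong[OF refl])
    fix p
    have "(\<Sum>i'<n. ?c (real p) * (if i' = i then 1 else 0) * tmat_block A p q $$ (i', j)) =
        (\<Sum>i'<n. if i' = i then ?c (real p) * tmat_block A p q $$ (i', j) else 0)"
      by (intro sum.cong) auto
    then show "(\<Sum>i'<n. ?c (real p) * (if i' = i then 1 else 0) * tmat_block A p q $$ (i', j)) =
        ?c (real p) * tmat_block A p q $$ (i, j)" using i by simp
  qed
  also have "\<dots> = (\<Sum>p<n3. \<Sum>l<n3. (A ! l) $$ (i, j) * (?c (real p) * th_coeff n3 l p q))"
    using i j q by (intro sum.cong) (simp_all add: tmat_block_entry[OF A] sum_distrib_left ac_simps)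
  also have "\<dots> = (\<Sum>l<n3. (A ! l) $$ (i, j) * (\<Sum>p<n3. ?c (real p) * th_coeff n3 l p q))"
    by (subst sum.swap) (simp add: sum_distrib_left)
  also have "\<dots> = (\<Sum>l<n3. M_mat n3 $$ (k, l) * (A ! l) $$ (i, j)) * ?c (real q)"
    unfolding sum_distrib_right
    by (intro sum.cong refl, subst sum_dct_wave_th_coeff[OF k _ q]) (simp_all add: ac_simps)
  also have "\<dots> = (L_trans A ! k) $$ (i, j) * ?c (real q)"
    using i j by (simp add: L_trans_index[OF A k])
  also have "\<dots> = (\<Sum>i'<n. if i' = j then (L_trans A ! k) $$ (i, i') * ?c (real q) else 0)"
    using j by simp
  also have "\<dots> = (\<Sum>i'<n. (L_trans A ! k) $$ (i, i') * block_wave n n3 k $$ (i', y))"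
    using y by (intro sum.cong) (auto simp: block_wave_def q_def j_def)
  also have "\<dots> = (L_trans A ! k * block_wave n n3 k) $$ (i, y)"
    using i y D by (simp add: block_wave_def scalar_prod_def atLeast0LessThan)
  finally show "(block_wave n n3 k * tmat A) $$ (i, y) = (L_trans A ! k * block_wave n n3 k) $$ (i, y)" .
qed (use tmat_carrier[OF A] k L_trans_slice_carrier[OF A k] in \<open>auto simp: block_wave_def\<close>)

lemma intertwine_pow:
  fixes E T D :: "'a::semiring_1 mat"
  assumes E: "E \<in> carrier_mat n m" and T: "T \<in> carrier_mat m m" and D: "D \<in> carrier_mat n n"
    and eq: "E * T = D * E"
  shows "E * T ^\<^sub>m k = D ^\<^sub>m k * E"
proof (induction k)
  case (Suc k)
  have p: "T ^\<^sub>m k \<in> carrier_mat m m" "D ^\<^sub>m k \<in> carrier_mat n n" using T D by auto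
  have "E * T ^\<^sub>m Suc k = E * T ^\<^sub>m k * T" using assoc_mult_mat[OF E p(1) T] by simp
  also have "\<dots> = D ^\<^sub>m k * (D * E)" using assoc_mult_mat[OF p(2) E T] by (simp add: Suc.IH eq)
  also have "\<dots> = D ^\<^sub>m Suc k * E" using assoc_mult_mat[OF p(2) D E] by simp
  finally show ?case .
qed (use E T D in simp)

text \<open>
  It suffices to look at the first block, which is a nonzero multiple of the identity.
\<close>

lemma block_wave_right_inverse:
  assumes "k < n3"
  shows "\<exists>F \<in> carrier_mat (n * n3) n. block_wave n n3 k * F = 1\<^sub>m n"
proof -
  let ?c = "complex_of_real (dct_wave n3 k 0)"
  define F where "F = mat (n * n3) n (\<lambda>(x, j). if x = j then inverse ?c else 0)"
  have F: "F \<in> carrier_mat (n * n3) n" by (simp add: F_def)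
  have "block_wave n n3 k * F = 1\<^sub>m n"
  proof (rule eq_matI)
    fix i j assume "i < dim_row (1\<^sub>m n :: complex mat)" "j < dim_col (1\<^sub>m n :: complex mat)"
    then have ij: "i < n" "j < n" by auto
    have jn: "j < n * n3" using ij assms by (cases n3) auto
    have "(block_wave n n3 k * F) $$ (i, j) = (\<Sum>x<n * n3. block_wave n n3 k $$ (i, x) * F $$ (x, j))"
      using ij F by (simp add: block_wave_def scalar_prod_def atLeast0LessThan)
    also have "\<dots> = (\<Sum>x<n * n3. if x = j then block_wave n n3 k $$ (i, x) * inverse ?c else 0)"
      using ij by (intro sum.cong) (auto simp: F_def)
    also have "\<dots> = 1\<^sub>m n $$ (i, j)"
      using ij jn dct_wave_0_pos[OF assms] by (auto simp: block_wave_def)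
    finally show "(block_wave n n3 k * F) $$ (i, j) = 1\<^sub>m n $$ (i, j)" .
  qed (use F in \<open>auto simp: block_wave_def\<close>)
  with F show ?thesis by blast
qed

text \<open>
  With \<open>E\<close> the block eigenvector for slice \<open>i\<close>, multiply \<open>T\<^sup>k\<^sup>+\<^sup>1 Y = T\<^sup>k\<close> by \<open>E\<close> on the left and by a right
  inverse \<open>F\<close> of \<open>E\<close> on the right: the powers of \<open>T\<close> turn into powers of the slice, with the new
  factor \<open>E Y F\<close>.
\<close>

lemma L_trans_tindex_factor:
  assumes A: "A \<in> tensor_carrier n n n3" and i: "i < n3"
  shows "\<exists>Y \<in> carrier_mat n n. (L_trans A ! i) ^\<^sub>m (tindex A + 1) * Y = (L_trans A ! i) ^\<^sub>m tindex A"
proof -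
  define T D E k where "T = tmat A" and "D = L_trans A ! i" and "E = block_wave n n3 i" and "k = tindex A"
  have T: "T \<in> carrier_mat (n * n3) (n * n3)" using tmat_carrier[OF A] i by (simp add: T_def)
  have D: "D \<in> carrier_mat n n" unfolding D_def by (rule L_trans_slice_carrier[OF A i])
  have E: "E \<in> carrier_mat n (n * n3)" by (simp add: E_def block_wave_carrier)
  have ET: "E * T ^\<^sub>m m = D ^\<^sub>m m * E" for m
    by (rule intertwine_pow[OF E T D]) (simp add: E_def T_def D_def block_wave_tmat[OF A i])
  obtain F where F: "F \<in> carrier_mat (n * n3) n" "E * F = 1\<^sub>m n"
    using block_wave_right_inverse[OF i, of n] unfolding E_def by blast
  obtain Y where Y: "Y \<in> carrier_mat (n * n3) (n * n3)" "T ^\<^sub>m (k + 1) * Y = T ^\<^sub>m k"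
    using mindex_factor[OF T] unfolding k_def tindex_def T_def by blast
  have p: "T ^\<^sub>m m \<in> carrier_mat (n * n3) (n * n3)" "D ^\<^sub>m m \<in> carrier_mat n n" for m using T D by auto
  have EY: "E * Y \<in> carrier_mat n (n * n3)" using E Y by simp
  have "D ^\<^sub>m (k + 1) * (E * Y) = E * T ^\<^sub>m (k + 1) * Y"
    unfolding ET by (rule assoc_mult_mat[OF p(2) E Y(1), symmetric])
  also have "\<dots> = E * T ^\<^sub>m k" using assoc_mult_mat[OF E p(1) Y(1), of "k + 1"] Y(2) by simp
  finally have 1: "D ^\<^sub>m (k + 1) * (E * Y) = D ^\<^sub>m k * E" unfolding ET .
  have "D ^\<^sub>m (k + 1) * (E * Y * F) = D ^\<^sub>m k * E * F"
    unfolding assoc_mult_mat[OF p(2) EY F(1), symmetric] 1 ..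
  also have "\<dots> = D ^\<^sub>m k" using assoc_mult_mat[OF p(2) E F(1), of k] F(2) right_mult_one_mat[OF p(2)] by simp
  finally show ?thesis using EY F unfolding D_def k_def by (intro bexI[of _ "E * Y * F"]) auto
qed

section \<open>The decomposition of a tensor\<close>

theorem theorem4p4:
  fixes A :: ctensor and n1 n3 k :: nat
  assumes "A \<in> tensor_carrier n1 n1 n3"
    and "tindex A = k"
  shows "\<exists>(P :: ctensor) (C :: nat \<Rightarrow> complex mat) (N :: nat \<Rightarrow> complex mat)
           (s :: nat \<Rightarrow> nat) (t :: nat \<Rightarrow> nat).
    P \<in> tensor_carrier n1 n1 n3 \<and> tinvertible P \<and>
    (\<forall>i<n3.
      s i + t i = n1 \<and>
      C i \<in> carrier_mat (s i) (s i) \<and> invertible_mat (C i) \<and>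
      N i \<in> carrier_mat (t i) (t i) \<and>
      minv (L_trans P ! i) * core_part (L_trans A ! i) * (L_trans P ! i) =
        four_block_mat (C i) (0\<^sub>m (s i) (t i)) (0\<^sub>m (t i) (s i)) (0\<^sub>m (t i) (t i)) \<and>
      minv (L_trans P ! i) * nilpotent_part (L_trans A ! i) * (L_trans P ! i) =
        four_block_mat (0\<^sub>m (s i) (s i)) (0\<^sub>m (s i) (t i)) (0\<^sub>m (t i) (s i)) (N i) \<and>
      four_block_mat (C i) (0\<^sub>m (s i) (t i)) (0\<^sub>m (t i) (s i)) (N i) =
        minv (L_trans P ! i) * (core_part (L_trans A ! i) + nilpotent_part (L_trans A ! i))
          * (L_trans P ! i)) \<and>
    (\<exists>\<Phi> \<in> tensor_carrier n1 n1 n3.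
      (\<forall>i<n3. L_trans \<Phi> ! i =
        four_block_mat (C i) (0\<^sub>m (s i) (t i)) (0\<^sub>m (t i) (s i)) (N i)) \<and>
      A = P *\<^sub>c \<Phi> *\<^sub>c tinv P) \<and>
    (\<forall>r. (\<forall>i<n3. mrank (C i) = r) \<longrightarrow>
      (\<exists>CC \<in> tensor_carrier r r n3. \<exists>NN \<in> tensor_carrier (n1 - r) (n1 - r) n3.
        (\<forall>i<n3. L_trans CC ! i = C i \<and> L_trans NN ! i = N i) \<and>
        A = P *\<^sub>c tblock CC (tzero r (n1 - r) n3) (tzero (n1 - r) r n3) NN *\<^sub>c tinv P \<and>
        tinvertible CC \<and>
        tdrazin A = P *\<^sub>c tblock (tinv CC) (tzero r (n1 - r) n3) (tzero (n1 - r) r n3)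
                             (tzero (n1 - r) (n1 - r) n3) *\<^sub>c tinv P))"
proof -
  note A = assms(1)
  have LA: "L_trans A ! i \<in> carrier_mat n1 n1" if "i < n3" for i by (rule L_trans_slice_carrier[OF A that])
  have "\<forall>i. \<exists>P Q s C D t N. i < n3 \<longrightarrow> core_nilpotent_form n1 (L_trans A ! i) P Q s C D t N"
    using core_nilpotent_form_exists[OF LA] by blast
  then obtain Ps Qs s C D t N where
    form: "\<And>i. i < n3 \<Longrightarrow> core_nilpotent_form n1 (L_trans A ! i) (Ps i) (Qs i) (s i) (C i) (D i) (t i) (N i)"
    by metis
  have st: "s i + t i = n1" and PQ: "inverse_pair n1 (Ps i) (Qs i)" and CD: "inverse_pair (s i) (C i) (D i)"
    and N: "N i \<in> carrier_mat (t i) (t i)" and Aeq: "L_trans A ! i = Ps i * (C i \<oplus>\<^sub>d N i) * Qs i"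
    if "i < n3" for i
    using form[OF that] by (auto simp: core_nilpotent_form_def)
  note Pc = inverse_pairD[OF PQ] and Cc = inverse_pairD[OF CD]
  define P where "P = tensor_from_L n1 n1 n3 Ps"
  have P: "P \<in> tensor_carrier n1 n1 n3" unfolding P_def by (rule tensor_from_L(1)[OF Pc(1)])
  have LP: "L_trans P ! i = Ps i" if "i < n3" for i unfolding P_def by (rule tensor_from_L(2)[OF Pc(1) that])
  have invP: "inverse_pair n1 (L_trans P ! i) (Qs i)" if "i < n3" for i using PQ[OF that] by (simp add: LP[OF that])
  note tinvP = tinverse_L(1,2)[OF P invP]
  have LtP: "L_trans (tinv P) ! i = Qs i" if "i < n3" for i by (rule tinverse_L(3)[OF P invP that])
  have conj: "P *\<^sub>c B *\<^sub>c tinv P \<in> tensor_carrier n1 n1 n3 \<and>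
      (\<forall>i<n3. L_trans (P *\<^sub>c B *\<^sub>c tinv P) ! i = Ps i * L_trans B ! i * Qs i)"
    if B: "B \<in> tensor_carrier n1 n1 n3" for B
    using cprod_carrier[OF cprod_carrier[OF P B] tinvP(2)]
    by (auto simp: L_trans_cprod[OF cprod_carrier[OF P B] tinvP(2)] L_trans_cprod[OF P B] LP LtP)
  have A_eq: "A = P *\<^sub>c B *\<^sub>c tinv P"
    if B: "B \<in> tensor_carrier n1 n1 n3" "\<And>i. i < n3 \<Longrightarrow> L_trans B ! i = C i \<oplus>\<^sub>d N i" for B
    by (rule L_trans_inject[OF A]) (use conj[OF B(1)] B(2) Aeq in auto)
  have block: "C i \<oplus>\<^sub>d N i \<in> carrier_mat n1 n1" "C i \<oplus>\<^sub>d 0\<^sub>m (t i) (t i) \<in> carrier_mat n1 n1"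
    "0\<^sub>m (s i) (s i) \<oplus>\<^sub>d N i \<in> carrier_mat n1 n1"
    "C i \<oplus>\<^sub>d N i = four_block_mat (C i) (0\<^sub>m (s i) (t i)) (0\<^sub>m (t i) (s i)) (N i)"
    "C i \<oplus>\<^sub>d 0\<^sub>m (t i) (t i) = four_block_mat (C i) (0\<^sub>m (s i) (t i)) (0\<^sub>m (t i) (s i)) (0\<^sub>m (t i) (t i))"
    "0\<^sub>m (s i) (s i) \<oplus>\<^sub>d N i = four_block_mat (0\<^sub>m (s i) (s i)) (0\<^sub>m (s i) (t i)) (0\<^sub>m (t i) (s i)) (N i)"
    if "i < n3" for i
    using st[OF that] Cc(1)[OF that] N[OF that] by auto
  have slices: "s i + t i = n1 \<and>
      C i \<in> carrier_mat (s i) (s i) \<and> invertible_mat (C i) \<and>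
      N i \<in> carrier_mat (t i) (t i) \<and>
      minv (L_trans P ! i) * core_part (L_trans A ! i) * (L_trans P ! i) =
        four_block_mat (C i) (0\<^sub>m (s i) (t i)) (0\<^sub>m (t i) (s i)) (0\<^sub>m (t i) (t i)) \<and>
      minv (L_trans P ! i) * nilpotent_part (L_trans A ! i) * (L_trans P ! i) =
        four_block_mat (0\<^sub>m (s i) (s i)) (0\<^sub>m (s i) (t i)) (0\<^sub>m (t i) (s i)) (N i) \<and>
      four_block_mat (C i) (0\<^sub>m (s i) (t i)) (0\<^sub>m (t i) (s i)) (N i) =
        minv (L_trans P ! i) * (core_part (L_trans A ! i) + nilpotent_part (L_trans A ! i))
          * (L_trans P ! i)" if i: "i < n3" for i
  proof -
    obtain Y where Y: "Y \<in> carrier_mat n1 n1"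
      "(L_trans A ! i) ^\<^sub>m (mindex (L_trans A ! i) + 1) * Y = (L_trans A ! i) ^\<^sub>m mindex (L_trans A ! i)"
      using mindex_factor[OF LA[OF i]] by blast
    note parts = core_nilpotent_form_parts[OF form[OF i] LA[OF i] Y]
    have "core_part (L_trans A ! i) + nilpotent_part (L_trans A ! i) = L_trans A ! i"
      by (rule core_part_add_nilpotent_part[OF _ LA[OF i]])
        (use parts(1) Pc(1,2)[OF i] block(2)[OF i] in \<open>simp only: mult_carrier_mat[of _ n1 n1 _ n1]\<close>)
    then have sum: "core_part (L_trans A ! i) + nilpotent_part (L_trans A ! i) = Ps i * (C i \<oplus>\<^sub>d N i) * Qs i"
      using Aeq[OF i] by simp
    note cancel = conj_inverse_pair_cancel[OF PQ[OF i]]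
    have m: "minv (Ps i) = Qs i" by (rule minv_eq[OF PQ[OF i]])
    have "minv (L_trans P ! i) * core_part (L_trans A ! i) * (L_trans P ! i) = C i \<oplus>\<^sub>d 0\<^sub>m (t i) (t i)"
      unfolding LP[OF i] m parts(1) by (rule cancel[OF block(2)[OF i]])
    moreover have "minv (L_trans P ! i) * nilpotent_part (L_trans A ! i) * (L_trans P ! i) =
        0\<^sub>m (s i) (s i) \<oplus>\<^sub>d N i"
      unfolding LP[OF i] m parts(2) by (rule cancel[OF block(3)[OF i]])
    moreover have "minv (L_trans P ! i) * (core_part (L_trans A ! i) + nilpotent_part (L_trans A ! i)) *
        (L_trans P ! i) = C i \<oplus>\<^sub>d N i"
      unfolding LP[OF i] m sum by (rule cancel[OF block(1)[OF i]])
    ultimately show ?thesis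
      using st[OF i] Cc(1)[OF i] N[OF i] inverse_pair_invertible_mat[OF CD[OF i]] by simp
  qed
  have Phi: "\<exists>\<Phi> \<in> tensor_carrier n1 n1 n3.
      (\<forall>i<n3. L_trans \<Phi> ! i =
        four_block_mat (C i) (0\<^sub>m (s i) (t i)) (0\<^sub>m (t i) (s i)) (N i)) \<and>
      A = P *\<^sub>c \<Phi> *\<^sub>c tinv P"
  proof -
    define \<Phi> where "\<Phi> = tensor_from_L n1 n1 n3 (\<lambda>i. C i \<oplus>\<^sub>d N i)"
    have c: "\<Phi> \<in> tensor_carrier n1 n1 n3" unfolding \<Phi>_def by (rule tensor_from_L(1)[OF block(1)])
    have L: "L_trans \<Phi> ! i = C i \<oplus>\<^sub>d N i" if "i < n3" for i
      unfolding \<Phi>_def by (rule tensor_from_L(2)[OF block(1) that])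
    show ?thesis using c L A_eq[OF c L] block(4) by (intro bexI[of _ \<Phi>]) auto
  qed
  have equal_ranks: "\<exists>CC \<in> tensor_carrier r r n3. \<exists>NN \<in> tensor_carrier (n1 - r) (n1 - r) n3.
        (\<forall>i<n3. L_trans CC ! i = C i \<and> L_trans NN ! i = N i) \<and>
        A = P *\<^sub>c tblock CC (tzero r (n1 - r) n3) (tzero (n1 - r) r n3) NN *\<^sub>c tinv P \<and>
        tinvertible CC \<and>
        tdrazin A = P *\<^sub>c tblock (tinv CC) (tzero r (n1 - r) n3) (tzero (n1 - r) r n3)
                             (tzero (n1 - r) (n1 - r) n3) *\<^sub>c tinv P"
    if rank: "\<forall>i<n3. mrank (C i) = r" for r
  proof -
    have s: "s i = r" "t i = n1 - r" if "i < n3" for i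
      using mrank_invertible[OF CD[OF that]] rank that st[OF that] by auto
    \<comment> \<open>If there are no slices, then nothing bounds $r$, but the only tensor is the empty one.\<close>
    have size: "tensor_carrier (r + (n1 - r)) (r + (n1 - r)) n3 = tensor_carrier n1 n1 n3"
    proof (cases "n3 = 0")
      case False
      then show ?thesis using s[of 0] st[of 0] by simp
    qed (simp add: tensor_carrier_0)
    have CDr: "inverse_pair r (C i) (D i)" and Nr: "N i \<in> carrier_mat (n1 - r) (n1 - r)" if "i < n3" for i
      using CD[OF that] N[OF that] s[OF that] by auto
    note Cr = inverse_pairD[OF CDr]
    define CC NN where "CC = tensor_from_L r r n3 C" and "NN = tensor_from_L (n1 - r) (n1 - r) n3 N"
    have CC: "CC \<in> tensor_carrier r r n3" unfolding CC_def by (rule tensor_from_L(1)[OF Cr(1)])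
    have NN: "NN \<in> tensor_carrier (n1 - r) (n1 - r) n3" unfolding NN_def by (rule tensor_from_L(1)[OF Nr])
    have LC: "L_trans CC ! i = C i" if "i < n3" for i unfolding CC_def by (rule tensor_from_L(2)[OF Cr(1) that])
    have LN: "L_trans NN ! i = N i" if "i < n3" for i unfolding NN_def by (rule tensor_from_L(2)[OF Nr that])
    have invC: "inverse_pair r (L_trans CC ! i) (D i)" if "i < n3" for i using CDr[OF that] by (simp add: LC[OF that])
    note tinvC = tinverse_L(1,2)[OF CC invC]
    have LtC: "L_trans (tinv CC) ! i = D i" if "i < n3" for i by (rule tinverse_L(3)[OF CC invC that])
    define Z where "Z = tzero (n1 - r) (n1 - r) n3"
    have Z: "Z \<in> tensor_carrier (n1 - r) (n1 - r) n3" unfolding Z_def by (rule tzero_carrier)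
    define B1 B2 where "B1 = tblock CC (tzero r (n1 - r) n3) (tzero (n1 - r) r n3) NN"
      and "B2 = tblock (tinv CC) (tzero r (n1 - r) n3) (tzero (n1 - r) r n3) Z"
    have B: "B1 \<in> tensor_carrier n1 n1 n3" "B2 \<in> tensor_carrier n1 n1 n3"
      using tblock_diag_carrier[OF CC NN] tblock_diag_carrier[OF tinvC(2) Z] by (simp_all add: size B1_def B2_def)
    have LB1: "L_trans B1 ! i = C i \<oplus>\<^sub>d N i" if "i < n3" for i
      using L_trans_tblock_diag[OF CC NN that] by (simp only: B1_def LC[OF that] LN[OF that])
    have LB2: "L_trans B2 ! i = D i \<oplus>\<^sub>d 0\<^sub>m (t i) (t i)" if "i < n3" for i
      using L_trans_tblock_diag[OF tinvC(2) Z that]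
      by (simp only: B2_def LtC[OF that] Z_def L_trans_tzero[OF that] s(2)[OF that])
    have "tdrazin A = P *\<^sub>c B2 *\<^sub>c tinv P"
    proof (rule tdrazin_eqI[OF A])
      show "P *\<^sub>c B2 *\<^sub>c tinv P \<in> tensor_carrier n1 n1 n3" using conj[OF B(2)] by blast
    next
      fix i assume i: "i < n3"
      obtain Y where Y: "Y \<in> carrier_mat n1 n1"
        "(L_trans A ! i) ^\<^sub>m (tindex A + 1) * Y = (L_trans A ! i) ^\<^sub>m tindex A"
        using L_trans_tindex_factor[OF A i] by blast
      have "L_trans (P *\<^sub>c B2 *\<^sub>c tinv P) ! i = Ps i * (D i \<oplus>\<^sub>d 0\<^sub>m (t i) (t i)) * Qs i"
        using conj[OF B(2)] i LB2[OF i] by metis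
      then show "is_drazin (tindex A) (L_trans A ! i) (L_trans (P *\<^sub>c B2 *\<^sub>c tinv P) ! i)"
        using core_nilpotent_form_drazin[OF form[OF i] nilpotent_pow_zero[OF form[OF i] Y]] by (simp only:)
    qed
    with A_eq[OF B(1) LB1] tinvC(1) CC NN LC LN show ?thesis
      unfolding B1_def B2_def Z_def by (intro bexI[of _ CC] bexI[of _ NN]) auto
  qed
  show ?thesis
    by (rule exI[of _ P], rule exI[of _ C], rule exI[of _ N], rule exI[of _ s], rule exI[of _ t],
        intro conjI, rule P, rule tinvP(1), assumption, intro allI impI, erule slices, rule Phi,
        intro allI impI, erule equal_ranks)
qed

end
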